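(* (1) Let $X$ be a Banach space containing an isomorphic copy of $\ell_1$. Then $\operatorname{bs}(B_X)=2$. In particular $\operatorname{bs}(B_{\ell_1})=2$ and $\operatorname{wbs}(B_{\ell_1})=0$. (2) Let $X$ be a nonreflexive Banach space containing no isomorphic copy of $\ell_1$. Then $\operatorname{bs}(B_X)\in[1,2]$. In particular $\operatorname{bs}(B_{c_0})=1$, $\operatorname{bs}(B_c)=2$ and $\operatorname{wbs}(B_{c_0})=\operatorname{wbs}(B_c)=0$.
   Context: $B_X$ is the closed unit ball of $X$; $c_0$ is the space of null sequences and $c$ the space of convergent sequences, both with the supremum norm. For a bounded sequence: $\operatorname{ca}(x_k)=\inf_{n}\sup\{\|x_k-x_l\|: k,l\ge n\}$, $\operatorname{cca}(x_k)=\operatorname{ca}(\frac1k\sum_{i=1}^k x_i)$, $\widetilde{\operatorname{cca}}(x_k)=\inf$ of $\operatorname{cca}$ over all subsequences. $\operatorname{bs}(A)=\sup\{\widetilde{\operatorname{cca}}(x_k): (x_k)\subset A\}$ and $\operatorname{wbs}(A)=\sup\{\widetilde{\operatorname{cca}}(x_k): (x_k)\subset A\text{ weakly convergent}\}$. *)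

theory Defs
  imports "HOL-Analysis.Analysis" "HOL-Library.Function_Algebras"
begin

instantiation "fun" :: (type, real_vector) real_vector
begin
definition scaleR_fun :: "real \<Rightarrow> ('a \<Rightarrow> 'b) \<Rightarrow> 'a \<Rightarrow> 'b"
  where "scaleR_fun r f = (\<lambda>x. r *\<^sub>R f x)"
instance
  by standard (auto simp: scaleR_fun_def fun_eq_iff scaleR_add_right scaleR_add_left)
end

section \<open>Normed spaces given by a carrier V (a linear subspace) and a norm N\<close>

definition cont_lin_functional :: "'v::real_vector set \<Rightarrow> ('v \<Rightarrow> real) \<Rightarrow> ('v \<Rightarrow> real) \<Rightarrow> bool"
  where "cont_lin_functional V N f \<longleftrightarrow>
     (\<forall>x\<in>V. \<forall>y\<in>V. \<forall>a b. f (a *\<^sub>R x + b *\<^sub>R y) = a * f x + b * f y) \<and>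
     (\<exists>K. \<forall>x\<in>V. \<bar>f x\<bar> \<le> K * N x)"

definition weakly_converges_to :: "'v::real_vector set \<Rightarrow> ('v \<Rightarrow> real) \<Rightarrow> (nat \<Rightarrow> 'v) \<Rightarrow> 'v \<Rightarrow> bool"
  where "weakly_converges_to V N x l \<longleftrightarrow> range x \<subseteq> V \<and> l \<in> V \<and>
     (\<forall>f. cont_lin_functional V N f \<longrightarrow> (\<lambda>k. f (x k)) \<longlonglongrightarrow> f l)"

definition weakly_convergent :: "'v::real_vector set \<Rightarrow> ('v \<Rightarrow> real) \<Rightarrow> (nat \<Rightarrow> 'v) \<Rightarrow> bool"
  where "weakly_convergent V N x \<longleftrightarrow> (\<exists>l. weakly_converges_to V N x l)"

definition ca :: "('v::real_vector \<Rightarrow> real) \<Rightarrow> (nat \<Rightarrow> 'v) \<Rightarrow> real"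
  where "ca N x = (INF n. SUP k\<in>{n..}. SUP l\<in>{n..}. N (x k - x l))"

text \<open>Cesaro means: index k (from 0) is the mean (1/(k+1)) * sum of the first k+1 terms,
  i.e. the paper's (1/k) sum_{i=1}^k x_i with 1-based indexing.\<close>
definition cesaro :: "(nat \<Rightarrow> 'v::real_vector) \<Rightarrow> nat \<Rightarrow> 'v"
  where "cesaro x k = (1 / real (Suc k)) *\<^sub>R (\<Sum>i\<le>k. x i)"

definition cca :: "('v::real_vector \<Rightarrow> real) \<Rightarrow> (nat \<Rightarrow> 'v) \<Rightarrow> real"
  where "cca N x = ca N (cesaro x)"

definition cca_tilde :: "('v::real_vector \<Rightarrow> real) \<Rightarrow> (nat \<Rightarrow> 'v) \<Rightarrow> real"
  where "cca_tilde N x = (INF r\<in>{r::nat\<Rightarrow>nat. strict_mono r}. cca N (x \<circ> r))"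

definition bs :: "('v::real_vector \<Rightarrow> real) \<Rightarrow> 'v set \<Rightarrow> real"
  where "bs N A = (SUP x\<in>{x::nat\<Rightarrow>'v. range x \<subseteq> A}. cca_tilde N x)"

definition wbs :: "'v::real_vector set \<Rightarrow> ('v \<Rightarrow> real) \<Rightarrow> 'v set \<Rightarrow> real"
  where "wbs V N A = (SUP x\<in>{x::nat\<Rightarrow>'v. range x \<subseteq> A \<and> weakly_convergent V N x}. cca_tilde N x)"

definition l1 :: "(nat \<Rightarrow> real) set" where "l1 = {x. summable (\<lambda>n. \<bar>x n\<bar>)}"
definition l1_norm :: "(nat \<Rightarrow> real) \<Rightarrow> real" where "l1_norm x = (\<Sum>n. \<bar>x n\<bar>)"

definition c0 :: "(nat \<Rightarrow> real) set" where "c0 = {x. x \<longlonglongrightarrow> 0}"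
definition c_conv :: "(nat \<Rightarrow> real) set" where "c_conv = {x. convergent x}"
definition sup_norm :: "(nat \<Rightarrow> real) \<Rightarrow> real" where "sup_norm x = (SUP n. \<bar>x n\<bar>)"

definition unit_ball :: "'v set \<Rightarrow> ('v \<Rightarrow> real) \<Rightarrow> 'v set"
  where "unit_ball V N = {x\<in>V. N x \<le> 1}"

definition contains_l1_copy :: "'v::real_vector set \<Rightarrow> ('v \<Rightarrow> real) \<Rightarrow> bool"
  where "contains_l1_copy V N \<longleftrightarrow> (\<exists>T::(nat\<Rightarrow>real) \<Rightarrow> 'v.
     (\<forall>a\<in>l1. T a \<in> V) \<and>
     (\<forall>a\<in>l1. \<forall>b\<in>l1. \<forall>s t. T (s *\<^sub>R a + t *\<^sub>R b) = s *\<^sub>R T a + t *\<^sub>R T b) \<and>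
     (\<exists>c C. 0 < c \<and> 0 < C \<and> (\<forall>a\<in>l1. c * l1_norm a \<le> N (T a) \<and> N (T a) \<le> C * l1_norm a)))"

definition canonical_embedding :: "'a::real_normed_vector \<Rightarrow> ('a \<Rightarrow>\<^sub>L real) \<Rightarrow>\<^sub>L real"
  where "canonical_embedding x = Blinfun (\<lambda>f. blinfun_apply f x)"

definition reflexive_space :: "'a::real_normed_vector itself \<Rightarrow> bool"
  where "reflexive_space _ \<longleftrightarrow> surj (canonical_embedding :: 'a \<Rightarrow> _)"

end

theory Submission
  imports Defs "HOL-Library.Diagonal_Subsequence"
begin

text \<open>
  If every Cesaro mean \<open>c\<^sub>m\<close> of every subsequence satisfies
  \<open>N (c\<^sub>m - c\<^sub>n) \<ge> d (n - m) / (n + 1)\<close> for \<open>m < n\<close>, then \<open>cca_tilde \<ge> d\<close>.  Sequences of this kind come from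
  three sources.  James' distortion theorem turns a copy of \<open>\<ell>\<^sub>1\<close> into a nearly isometric \<open>\<ell>\<^sub>1\<close>-basis
  of blocks, which gives \<open>d\<close> close to 2.  In a nonreflexive space Riesz' lemma gives \<open>F\<close> in the unit ball of the
  bidual at distance almost 1 from the space; alternating finite sets of functionals that separate
  \<open>F\<close> from the convex hull of the points chosen so far with Goldstine approximations of \<open>F\<close> gives \<open>d\<close> close
  to 1.  In \<open>c\<^sub>0\<close> and \<open>c\<close> step functions do.
  The upper bounds for \<open>\<ell>\<^sub>1\<close>, \<open>c\<^sub>0\<close> and \<open>c\<close> are gliding hump arguments: the Schur property of \<open>\<ell>\<^sub>1\<close>, and in
  \<open>c\<^sub>0\<close> a subsequence whose Cesaro means are, up to \<open>O(1/n)\<close>, coordinatewise multiples \<open>\<alpha> x\<^sub>i\<close> with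
  \<open>\<alpha> \<in> [0,1]\<close> of the pointwise limit \<open>x\<close>.
\<close>

section \<open>Cesaro oscillation in normed spaces\<close>

text \<open>The sum of the terms up to n is (m + 1) times the mean c_m plus the terms after m. The
  identity turns a uniform lower bound on a functional of the differences c_m - x_j, j > m, into a
  gap between the two means.\<close>

lemma cesaro_split:
  assumes "m < n"
  shows "cesaro x m - cesaro x n =
    (1 / real (Suc n)) *\<^sub>R (\<Sum>j\<in>{m<..n}. cesaro x m - x j)"
proof -
  have split: "(\<Sum>j\<le>n. x j) = (\<Sum>j\<le>m. x j) + (\<Sum>j\<in>{m<..n}. x j)"
    using assms by (subst sum.union_disjoint[symmetric]) (auto intro!: sum.cong)
  have sum_m: "(\<Sum>j\<le>m. x j) = real (Suc m) *\<^sub>R cesaro x m"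
    by (simp add: cesaro_def)
  have "(\<Sum>j\<in>{m<..n}. cesaro x m - x j) = real (n - m) *\<^sub>R cesaro x m - (\<Sum>j\<in>{m<..n}. x j)"
    by (simp add: sum_subtractf sum_constant_scaleR)
  also have "\<dots> = real (Suc n) *\<^sub>R cesaro x m - (\<Sum>j\<le>n. x j)"
    using assms by (simp add: split sum_m of_nat_diff algebra_simps)
  finally show ?thesis
    by (simp add: scaleR_diff_right cesaro_def[of x n])
qed

text \<open>The axioms are restricted to \<open>V\<close> because \<open>l1_norm\<close> and
  \<open>sup_norm\<close> are functions on all real sequences and are meaningful only on their
  spaces; \<open>V = UNIV\<close> recovers a normed type.\<close>

locale normed_carrier =
  fixes V :: "'v::real_vector set" and N :: "'v \<Rightarrow> real"
  assumes subspace_V: "subspace V"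
    and N_triangle: "\<And>x y. x \<in> V \<Longrightarrow> y \<in> V \<Longrightarrow> N (x + y) \<le> N x + N y"
    and N_scaleR: "\<And>x a. x \<in> V \<Longrightarrow> N (a *\<^sub>R x) = \<bar>a\<bar> * N x"
begin

lemma N_zero: "N 0 = 0"
  using N_scaleR[of 0 0] subspace_0[OF subspace_V] by simp

lemma N_uminus: "x \<in> V \<Longrightarrow> N (- x) = N x"
  using N_scaleR[of x "-1"] by simp

lemma N_nonneg:
  assumes "x \<in> V"
  shows "0 \<le> N x"
proof -
  have "N (x + - x) \<le> N x + N (- x)"
    using assms by (intro N_triangle subspace_neg[OF subspace_V])
  then show ?thesis
    using assms by (simp add: N_zero N_uminus)
qed

lemma N_diff_le: "x \<in> V \<Longrightarrow> y \<in> V \<Longrightarrow> N (x - y) \<le> N x + N y"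
  using N_triangle[of x "- y"] by (simp add: N_uminus subspace_neg[OF subspace_V])

lemma N_sum_le: "(\<And>i. i \<in> I \<Longrightarrow> x i \<in> V) \<Longrightarrow> N (\<Sum>i\<in>I. x i) \<le> (\<Sum>i\<in>I. N (x i))"
proof (induction I rule: infinite_finite_induct)
  case (insert i I)
  then show ?case
    using N_triangle[of "x i" "sum x I"] by (force simp: subspace_sum[OF subspace_V])
qed (simp_all add: N_zero)

lemma cesaro_in_V: "range x \<subseteq> V \<Longrightarrow> cesaro x k \<in> V"
  unfolding cesaro_def by (intro subspace_scale[OF subspace_V] subspace_sum[OF subspace_V]) auto

lemma N_cesaro_le:
  assumes "range x \<subseteq> V"
  shows "N (cesaro x k) \<le> (\<Sum>i\<le>k. N (x i)) / real (Suc k)"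
proof -
  have "N (\<Sum>i\<le>k. x i) \<le> (\<Sum>i\<le>k. N (x i))"
    using assms by (intro N_sum_le) auto
  moreover have "N (cesaro x k) = N (\<Sum>i\<le>k. x i) / real (Suc k)"
    unfolding cesaro_def using assms
    by (subst N_scaleR) (auto intro!: subspace_sum[OF subspace_V])
  ultimately show ?thesis
    by (simp add: divide_right_mono)
qed

lemma cesaro_in_unit_ball:
  assumes "range x \<subseteq> unit_ball V N"
  shows "cesaro x k \<in> unit_ball V N"
proof -
  have V: "range x \<subseteq> V"
    using assms by (auto simp: unit_ball_def)
  have "(\<Sum>i\<le>k. N (x i)) \<le> (\<Sum>i\<le>k. 1)"
    using assms by (intro sum_mono) (auto simp: unit_ball_def)
  then have "(\<Sum>i\<le>k. N (x i)) / real (Suc k) \<le> 1"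
    by simp
  then show ?thesis
    using order_trans[OF N_cesaro_le[OF V, of k]] cesaro_in_V[OF V] by (simp add: unit_ball_def)
qed

lemma unit_ball_diff_le_2: "x \<in> unit_ball V N \<Longrightarrow> y \<in> unit_ball V N \<Longrightarrow> N (x - y) \<le> 2"
  using N_diff_le[of x y] by (auto simp: unit_ball_def)

section \<open>Oscillation of sequences in the unit ball\<close>

lemma oscillation_ge:
  fixes y :: "nat \<Rightarrow> 'v"
  assumes y: "range y \<subseteq> unit_ball V N" and "n \<le> k" "n \<le> l"
  shows "N (y k - y l) \<le> (SUP k\<in>{n..}. SUP l\<in>{n..}. N (y k - y l))"
proof -
  \<comment> \<open>The diameter bound 2 makes both nested suprema bounded, so that the real-valued
    SUP is a genuine least upper bound.\<close>
  have le2: "N (y i - y j) \<le> 2" for i j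
    using y by (intro unit_ball_diff_le_2) auto
  have "N (y k - y l) \<le> (SUP l\<in>{n..}. N (y k - y l))"
    using le2 \<open>n \<le> l\<close> by (intro cSUP_upper) (auto intro!: bdd_aboveI2)
  also have "\<dots> \<le> (SUP k\<in>{n..}. SUP l\<in>{n..}. N (y k - y l))"
    using le2 \<open>n \<le> k\<close>
    by (intro cSUP_upper[of k "{n..}" "\<lambda>k. SUP l\<in>{n..}. N (y k - y l)"])
       (auto intro!: bdd_aboveI2[where M = 2] cSUP_least)
  finally show ?thesis .
qed

lemma oscillation_nonneg:
  fixes y :: "nat \<Rightarrow> 'v"
  assumes "range y \<subseteq> unit_ball V N"
  shows "0 \<le> (SUP k\<in>{n..}. SUP l\<in>{n..}. N (y k - y l))"
  using oscillation_ge[OF assms order_refl order_refl, of n] by (simp add: N_zero)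

lemma ca_nonneg:
  fixes y :: "nat \<Rightarrow> 'v"
  assumes "range y \<subseteq> unit_ball V N"
  shows "0 \<le> ca N y"
  unfolding ca_def by (intro cINF_greatest oscillation_nonneg[OF assms]) auto

lemma ca_le:
  fixes y :: "nat \<Rightarrow> 'v"
  assumes y: "range y \<subseteq> unit_ball V N"
    and osc: "\<And>k l. n \<le> k \<Longrightarrow> n \<le> l \<Longrightarrow> N (y k - y l) \<le> d"
  shows "ca N y \<le> d"
proof -
  have "ca N y \<le> (SUP k\<in>{n..}. SUP l\<in>{n..}. N (y k - y l))"
    unfolding ca_def using oscillation_nonneg[OF y] by (intro cINF_lower) (auto intro!: bdd_belowI2[where m = 0])
  also have "\<dots> \<le> d"
    using osc by (intro cSUP_least) auto
  finally show ?thesis .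
qed

lemma ca_ge:
  fixes y :: "nat \<Rightarrow> 'v"
  assumes y: "range y \<subseteq> unit_ball V N"
    and osc: "\<And>n. \<exists>k\<ge>n. \<exists>l\<ge>n. d \<le> N (y k - y l)"
  shows "d \<le> ca N y"
  unfolding ca_def
proof (intro cINF_greatest)
  fix n
  show "d \<le> (SUP k\<in>{n..}. SUP l\<in>{n..}. N (y k - y l))"
    using osc[of n] oscillation_ge[OF y] by (meson order_trans)
qed auto

section \<open>Cesaro means of subsequences: bounds for \<open>cca_tilde\<close>, \<open>bs\<close>
  and \<open>wbs\<close>\<close>

lemma range_cesaro_comp:
  assumes "range x \<subseteq> unit_ball V N"
  shows "range (cesaro (x \<circ> r)) \<subseteq> unit_ball V N"
  using assms by (auto intro!: cesaro_in_unit_ball)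

lemma cca_tilde_le:
  assumes x: "range x \<subseteq> unit_ball V N" and r: "strict_mono r" and "cca N (x \<circ> r) \<le> d"
  shows "cca_tilde N x \<le> d"
proof -
  have "cca_tilde N x \<le> cca N (x \<circ> r)"
    unfolding cca_tilde_def cca_def using r ca_nonneg[OF range_cesaro_comp[OF x]]
    by (intro cINF_lower) (auto intro!: bdd_belowI2[where m = 0])
  with assms(3) show ?thesis
    by simp
qed

lemma cca_tilde_ge:
  assumes "\<And>r. strict_mono r \<Longrightarrow> d \<le> cca N (x \<circ> r)"
  shows "d \<le> cca_tilde N x"
  unfolding cca_tilde_def using assms strict_mono_id
  by (intro cINF_greatest) blast+

lemma cca_tilde_nonneg:
  assumes "range x \<subseteq> unit_ball V N"
  shows "0 \<le> cca_tilde N x"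
  by (intro cca_tilde_ge) (simp add: cca_def ca_nonneg[OF range_cesaro_comp[OF assms]])

lemma cca_tilde_le_2:
  assumes "range x \<subseteq> unit_ball V N"
  shows "cca_tilde N x \<le> 2"
proof (rule cca_tilde_le[OF assms strict_mono_id])
  show "cca N (x \<circ> id) \<le> 2"
    unfolding cca_def using range_cesaro_comp[OF assms, of id]
    by (intro ca_le[where n = 0] unit_ball_diff_le_2) auto
qed

text \<open>For fixed m the factor (n - m) / (n + 1) tends to 1 as n grows. Hence every tail of the
  means contains a pair whose distance is at least any prescribed e < d, whichever subsequence is
  taken.\<close>

lemma cca_tilde_ge_of_cesaro_gap:
  assumes x: "range x \<subseteq> unit_ball V N"
    and gap: "\<And>r m n. strict_mono r \<Longrightarrow> m < n \<Longrightarrow>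
      d * (real (n - m) / real (Suc n)) \<le> N (cesaro (x \<circ> r) m - cesaro (x \<circ> r) n)"
  shows "d \<le> cca_tilde N x"
proof (rule cca_tilde_ge)
  fix r :: "nat \<Rightarrow> nat" assume r: "strict_mono r"
  have lim: "(\<lambda>n. d * (real (n - m) / real (Suc n))) \<longlonglongrightarrow> d" for m
  proof -
    have "(\<lambda>n. d * (1 - real (Suc m) * inverse (real (Suc n)))) \<longlonglongrightarrow> d * (1 - real (Suc m) * 0)"
      by (intro tendsto_intros LIMSEQ_inverse_real_of_nat)
    \<comment> \<open>The equality holds from n = m on; below that, subtraction on the naturals
      truncates.\<close>
    moreover have "\<forall>\<^sub>F n in sequentially.
        d * (1 - real (Suc m) * inverse (real (Suc n))) = d * (real (n - m) / real (Suc n))"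
      using eventually_ge_at_top[of m] by eventually_elim (simp add: field_simps of_nat_diff)
    ultimately show ?thesis
      using tendsto_cong by fastforce
  qed
  have "e \<le> cca N (x \<circ> r)" if "e < d" for e
    unfolding cca_def
  proof (rule ca_ge[OF range_cesaro_comp[OF x]])
    fix m
    have "\<forall>\<^sub>F n in sequentially. e < d * (real (n - m) / real (Suc n)) \<and> m < n"
      using order_tendstoD(1)[OF lim[of m] that] eventually_gt_at_top[of m] by eventually_elim auto
    then obtain n where "e < d * (real (n - m) / real (Suc n))" "m < n"
      using eventually_happens' sequentially_bot by blast
    then show "\<exists>k\<ge>m. \<exists>l\<ge>m. e \<le> N (cesaro (x \<circ> r) k - cesaro (x \<circ> r) l)"
      using gap[OF r, of m n] by (intro exI[of _ m] conjI exI[of _ n]) auto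
  qed
  then show "d \<le> cca N (x \<circ> r)"
    by (rule dense_le)
qed

lemma bs_le:
  assumes "\<And>x. range x \<subseteq> unit_ball V N \<Longrightarrow> cca_tilde N x \<le> d"
  shows "bs N (unit_ball V N) \<le> d"
proof -
  \<comment> \<open>The zero sequence shows that the supremum is taken over a nonempty set.\<close>
  have "range (\<lambda>_::nat. 0) \<subseteq> unit_ball V N"
    using subspace_0[OF subspace_V] by (simp add: unit_ball_def N_zero)
  then show ?thesis
    unfolding bs_def using assms by (intro cSUP_least) blast+
qed

lemma bs_le_2: "bs N (unit_ball V N) \<le> 2"
  by (intro bs_le cca_tilde_le_2)

lemma bs_ge:
  assumes "range x \<subseteq> unit_ball V N" "d \<le> cca_tilde N x"
  shows "d \<le> bs N (unit_ball V N)"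
  unfolding bs_def using assms cca_tilde_le_2
  by (intro cSUP_upper2[of _ _ x]) (auto intro!: bdd_aboveI2)

lemma cca_tilde_le_0:
  assumes x: "range x \<subseteq> unit_ball V N" and l: "l \<in> V" and r: "strict_mono r"
    and lim: "(\<lambda>k. N (cesaro (x \<circ> r) k - l)) \<longlonglongrightarrow> 0"
  shows "cca_tilde N x \<le> 0"
proof (rule cca_tilde_le[OF x r], rule field_le_epsilon)
  fix e :: real assume "0 < e"
  then have "\<forall>\<^sub>F k in sequentially. N (cesaro (x \<circ> r) k - l) < e / 2"
    using order_tendstoD(2)[OF lim, of "e / 2"] by simp
  then obtain n where n: "\<And>k. n \<le> k \<Longrightarrow> N (cesaro (x \<circ> r) k - l) < e / 2"
    by (auto simp: eventually_sequentially)
  have V: "cesaro (x \<circ> r) k \<in> V" for k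
    using range_cesaro_comp[OF x, of r] by (auto simp: unit_ball_def)
  show "cca N (x \<circ> r) \<le> 0 + e"
    unfolding cca_def
  proof (rule ca_le[OF range_cesaro_comp[OF x], of n])
    fix k j assume "n \<le> k" "n \<le> j"
    then show "N (cesaro (x \<circ> r) k - cesaro (x \<circ> r) j) \<le> 0 + e"
      using n[of k] n[of j] N_diff_le[of "cesaro (x \<circ> r) k - l" "cesaro (x \<circ> r) j - l"]
        V l subspace_diff[OF subspace_V] by auto
  qed
qed

lemma wbs_eq_0:
  assumes "\<And>x l. range x \<subseteq> unit_ball V N \<Longrightarrow> weakly_converges_to V N x l \<Longrightarrow> cca_tilde N x \<le> 0"
  shows "wbs V N (unit_ball V N) = 0"
proof -
  \<comment> \<open>Again a witness that the index set is nonempty, so that the supremum of the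
    constant 0 over it is 0.\<close>
  have z: "range (\<lambda>_::nat. 0) \<subseteq> unit_ball V N \<and> weakly_convergent V N (\<lambda>_. 0)"
    using subspace_0[OF subspace_V]
    by (auto simp: unit_ball_def N_zero weakly_convergent_def weakly_converges_to_def intro!: exI[of _ 0])
  have eq: "cca_tilde N x = 0" if "range x \<subseteq> unit_ball V N \<and> weakly_convergent V N x" for x
    using that assms[of x] cca_tilde_nonneg[of x] by (auto simp: weakly_convergent_def intro: antisym)
  have "wbs V N (unit_ball V N)
      = (SUP x\<in>{x::nat\<Rightarrow>'v. range x \<subseteq> unit_ball V N \<and> weakly_convergent V N x}. 0)"
    unfolding wbs_def by (intro SUP_cong) (use eq in auto)
  also have "\<dots> = 0"
    using z by (intro cSUP_const) blast
  finally show ?thesis .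
qed

end

section \<open>Norming functionals\<close>

definition sublinear :: "('a::real_vector \<Rightarrow> real) \<Rightarrow> bool"
  where "sublinear q \<longleftrightarrow> (\<forall>x y. q (x + y) \<le> q x + q y) \<and> (\<forall>t x. 0 < t \<longrightarrow> q (t *\<^sub>R x) = t * q x)"

text \<open>A sublinear functional that is minimal is linear, because it equals all of its shifts.\<close>

definition sublinear_shift :: "('a::real_vector \<Rightarrow> real) \<Rightarrow> 'a \<Rightarrow> 'a \<Rightarrow> real"
  where "sublinear_shift q a y = (INF t\<in>{0..}. q (y + t *\<^sub>R a) - t * q a)"

lemma sublinear_add: "sublinear q \<Longrightarrow> q (x + y) \<le> q x + q y"
  by (simp add: sublinear_def)

lemma sublinear_scaleR: "sublinear q \<Longrightarrow> 0 < t \<Longrightarrow> q (t *\<^sub>R x) = t * q x"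
  by (simp add: sublinear_def)

lemma sublinear_zero: "sublinear q \<Longrightarrow> q 0 = 0"
  using sublinear_scaleR[of q 2 0] by simp

lemma sublinear_scaleR': "sublinear q \<Longrightarrow> 0 \<le> t \<Longrightarrow> q (t *\<^sub>R x) = t * q x"
  by (cases "t = 0") (auto simp: sublinear_zero sublinear_scaleR)

lemma sublinear_uminus: "sublinear q \<Longrightarrow> - q (- x) \<le> q x"
  using sublinear_add[of q x "- x"] sublinear_zero[of q] by simp

text \<open>Since t * q a = q (t a) <= q (- y) + q (y + t a), the number - q (- y) is a lower bound
  independent of t.\<close>

lemma sublinear_shift_bdd:
  assumes "sublinear q"
  shows "bdd_below ((\<lambda>t. q (y + t *\<^sub>R a) - t * q a) ` {0..})"
proof (rule bdd_belowI2)
  fix t :: real assume "t \<in> {0..}"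
  then show "- q (- y) \<le> q (y + t *\<^sub>R a) - t * q a"
    using sublinear_add[OF assms, of "- y" "y + t *\<^sub>R a"] sublinear_scaleR'[OF assms, of t a] by simp
qed

lemma sublinear_shift_le_at:
  "sublinear q \<Longrightarrow> 0 \<le> t \<Longrightarrow> sublinear_shift q a y \<le> q (y + t *\<^sub>R a) - t * q a"
  unfolding sublinear_shift_def by (intro cINF_lower sublinear_shift_bdd) auto

lemma sublinear_shift_le: "sublinear q \<Longrightarrow> sublinear_shift q a \<le> q"
  using sublinear_shift_le_at[of q 0 a] by (auto simp: le_fun_def)

text \<open>Parameters s for x and t for y give the competitor s + t for x + y; infima over s and
  then t yield subadditivity. For homogeneity the parameter s for x corresponds to t * s for t x,
  and the reverse inequality is the same one with 1 / t.\<close>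

lemma sublinear_sublinear_shift:
  fixes q :: "'a::real_vector \<Rightarrow> real"
  assumes q: "sublinear q"
  shows "sublinear (sublinear_shift q a)"
  unfolding sublinear_def
proof (intro conjI allI impI)
  let ?f = "\<lambda>y t. q (y + t *\<^sub>R a) - t * q a"
  fix x y :: 'a
  have *: "sublinear_shift q a (x + y) \<le> ?f x s + ?f y t" if "0 \<le> s" "0 \<le> t" for s t
    using sublinear_shift_le_at[OF q, of "s + t" a "x + y"]
      sublinear_add[OF q, of "x + s *\<^sub>R a" "y + t *\<^sub>R a"] that by (simp add: algebra_simps)
  have "sublinear_shift q a (x + y) - ?f y t \<le> sublinear_shift q a x" if "0 \<le> t" for t
    unfolding sublinear_shift_def[of q a x] using *[OF _ that] by (intro cINF_greatest) (auto simp: algebra_simps)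
  then have "sublinear_shift q a (x + y) - sublinear_shift q a x \<le> sublinear_shift q a y"
    unfolding sublinear_shift_def[of q a y] by (intro cINF_greatest) (auto simp: algebra_simps)
  then show "sublinear_shift q a (x + y) \<le> sublinear_shift q a x + sublinear_shift q a y"
    by simp
next
  have le: "sublinear_shift q a (t *\<^sub>R x) \<le> t * sublinear_shift q a x" if "0 < t" for t x
  proof -
    have "sublinear_shift q a (t *\<^sub>R x) / t \<le> q (x + s *\<^sub>R a) - s * q a" if "0 \<le> s" for s
    proof -
      have "sublinear_shift q a (t *\<^sub>R x) \<le> q (t *\<^sub>R (x + s *\<^sub>R a)) - t * s * q a"
        using sublinear_shift_le_at[OF q, of "t * s" a "t *\<^sub>R x"] \<open>0 < t\<close> that by (simp add: algebra_simps)
      then have "sublinear_shift q a (t *\<^sub>R x) \<le> (q (x + s *\<^sub>R a) - s * q a) * t"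
        unfolding sublinear_scaleR[OF q \<open>0 < t\<close>] by (simp add: algebra_simps)
      then show ?thesis
        using \<open>0 < t\<close> by (simp add: pos_divide_le_eq)
    qed
    then have "sublinear_shift q a (t *\<^sub>R x) / t \<le> sublinear_shift q a x"
      unfolding sublinear_shift_def[of q a x] by (intro cINF_greatest) auto
    then show ?thesis
      using \<open>0 < t\<close> by (simp add: field_simps)
  qed
  fix t :: real and x :: 'a assume t: "0 < t"
  have "t * sublinear_shift q a x \<le> sublinear_shift q a (t *\<^sub>R x)"
    using le[of "1 / t" "t *\<^sub>R x"] t by (simp add: field_simps)
  with le[OF t, of x] show "sublinear_shift q a (t *\<^sub>R x) = t * sublinear_shift q a x"
    by simp
qed

text \<open>Zorn's lemma for the pointwise order read downwards. A nonempty chain has its pointwise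
  infimum as lower bound, which is finite because each member f satisfies f x >= - p (- x).\<close>

lemma exists_minimal_sublinear:
  fixes p :: "'a::real_vector \<Rightarrow> real"
  assumes p: "sublinear p"
  obtains q where "sublinear q" "q \<le> p" "\<And>q'. sublinear q' \<Longrightarrow> q' \<le> q \<Longrightarrow> q' = q"
proof -
  define A where "A = {q. sublinear q \<and> q \<le> p}"
  have "\<exists>m\<in>A. \<forall>q\<in>A. q \<le> m \<longrightarrow> q = m"
  proof (rule predicate_Zorn)
    show "partial_order_on A (relation_of (\<lambda>f g. g \<le> f) A)"
      by (rule partial_order_on_relation_ofI) auto
    fix C assume "C \<in> Chains (relation_of (\<lambda>f g. g \<le> f) A)"
    then have CA: "C \<subseteq> A" and chain: "\<And>f g. f \<in> C \<Longrightarrow> g \<in> C \<Longrightarrow> f \<le> g \<or> g \<le> f"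
      by (auto simp: Chains_def relation_of_def)
    show "\<exists>u\<in>A. \<forall>f\<in>C. u \<le> f"
    proof (cases "C = {}")
      case True
      then show ?thesis
        using p by (auto simp: A_def)
    next
      case False
      define u where "u x = (INF f\<in>C. f x)" for x
      have sub: "sublinear f" "f \<le> p" if "f \<in> C" for f
        using CA that by (auto simp: A_def)
      have "- p (- x) \<le> f x" if "f \<in> C" for f x
        using sublinear_uminus[OF sub(1)[OF that], of x] le_funD[OF sub(2)[OF that], of "- x"] by simp
      then have bdd: "bdd_below ((\<lambda>f. f x) ` C)" for x
        by (intro bdd_belowI2)
      have u_le: "u x \<le> f x" if "f \<in> C" for f x
        unfolding u_def using that bdd by (rule cINF_lower[rotated])
      have u_ge: "z \<le> u x" if "\<And>f. f \<in> C \<Longrightarrow> z \<le> f x" for z x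
        unfolding u_def using that False by (intro cINF_greatest) auto
      have "sublinear u"
        unfolding sublinear_def
      proof (intro conjI allI impI)
        fix x y
        \<comment> \<open>Here the chain property enters: the smaller of f and g lies below both,
          and its own subadditivity gives the estimate.\<close>
        have *: "u (x + y) \<le> f x + g y" if fg: "f \<in> C" "g \<in> C" for f g
          using chain[OF fg]
        proof
          assume "f \<le> g"
          then show ?thesis
            using u_le[OF fg(1), of "x + y"] sublinear_add[OF sub(1)[OF fg(1)], of x y] le_funD[of f g y]
            by simp
        next
          assume "g \<le> f"
          then show ?thesis
            using u_le[OF fg(2), of "x + y"] sublinear_add[OF sub(1)[OF fg(2)], of x y] le_funD[of g f x]
            by simp
        qed
        have "u (x + y) - g y \<le> u x" if "g \<in> C" for g
          using *[OF _ that] by (intro u_ge) (simp add: algebra_simps)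
        then have "u (x + y) - u x \<le> u y"
          by (intro u_ge) (simp add: algebra_simps)
        then show "u (x + y) \<le> u x + u y"
          by simp
      next
        have le: "u (t *\<^sub>R x) \<le> t * u x" if "0 < t" for t x
        proof -
          have "u (t *\<^sub>R x) / t \<le> u x"
            using that u_le[of _ "t *\<^sub>R x"] sublinear_scaleR[OF sub(1)]
            by (intro u_ge) (auto simp: field_simps)
          then show ?thesis
            using that by (simp add: field_simps)
        qed
        fix t :: real and x assume t: "0 < t"
        show "u (t *\<^sub>R x) = t * u x"
          using le[OF t, of x] le[of "1 / t" "t *\<^sub>R x"] t by (simp add: field_simps)
      qed
      moreover have "u \<le> p"
        using False sub(2) u_le by (meson ex_in_conv le_funI le_funD order_trans)
      ultimately show ?thesis
        using u_le by (auto simp: A_def le_fun_def)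
    qed
  qed
  then obtain m where "m \<in> A" "\<And>q. q \<in> A \<Longrightarrow> q \<le> m \<Longrightarrow> q = m"
    by blast
  then show thesis
    using that[of m] by (auto simp: A_def intro: order_trans)
qed

lemma minimal_sublinear_linear:
  fixes q :: "'a::real_vector \<Rightarrow> real"
  assumes q: "sublinear q" and minimal: "\<And>q'. sublinear q' \<Longrightarrow> q' \<le> q \<Longrightarrow> q' = q"
  shows "linear q"
proof -
  have shift: "sublinear_shift q a = q" for a
    by (intro minimal sublinear_sublinear_shift sublinear_shift_le q)
  \<comment> \<open>The parameter 1 in the shift by y gives q x <= q (x + y) - q y, the missing half
    of additivity.\<close>
  have add: "q (x + y) = q x + q y" for x y
    using sublinear_shift_le_at[OF q, of 1 y x] sublinear_add[OF q, of x y] by (simp add: shift)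
  have minus: "q (- x) = - q x" for x
    using add[of x "- x"] sublinear_zero[OF q] by simp
  have "q (t *\<^sub>R x) = t * q x" for t x
  proof (cases "0 \<le> t")
    case False
    then show ?thesis
      using sublinear_scaleR'[OF q, of "- t" x] minus[of "t *\<^sub>R x"] by simp
  qed (simp add: sublinear_scaleR'[OF q])
  then show ?thesis
    by (intro linearI) (simp_all add: add)
qed

text \<open>A minimal sublinear functional is taken below the shift of the norm by \<open>a\<close>,
  not just below the norm: with parameter 1 the shift is at most - norm a at - a. A linear q below
  it therefore has q a >= norm a, and q <= norm gives equality.\<close>

lemma exists_norming_functional:
  fixes a :: "'a::real_normed_vector"
  obtains f :: "'a \<Rightarrow>\<^sub>L real" where "norm f \<le> 1" "blinfun_apply f a = norm a"
proof -
  have norm: "sublinear (norm :: 'a \<Rightarrow> real)"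
    by (simp add: sublinear_def norm_triangle_ineq)
  obtain q where q: "sublinear q" "q \<le> sublinear_shift norm a"
    and minimal: "\<And>q'. sublinear q' \<Longrightarrow> q' \<le> q \<Longrightarrow> q' = q"
    using exists_minimal_sublinear[OF sublinear_sublinear_shift[OF norm, of a]] by metis
  have lin: "linear q"
    by (rule minimal_sublinear_linear[OF q(1) minimal])
  have le: "q x \<le> norm x" for x
    using order_trans[OF q(2) sublinear_shift_le[OF norm]] by (simp add: le_fun_def)
  have abs_le: "\<bar>q x\<bar> \<le> norm x" for x
    using le[of x] le[of "- x"] linear_neg[OF lin, of x] by simp
  then have bl: "bounded_linear q"
    using lin by (intro bounded_linear_intro[of _ 1])
      (auto simp: linear_add linear_scale)
  have "q (- a) \<le> - norm a"
    using le_funD[OF q(2), of "- a"] sublinear_shift_le_at[OF norm, of 1 a "- a"] by simp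
  then have "q a = norm a"
    using le[of a] linear_neg[OF lin, of a] by simp
  moreover have "norm (Blinfun q) \<le> 1"
    using abs_le by (intro norm_blinfun_bound) (simp_all add: bounded_linear_Blinfun_apply[OF bl])
  ultimately show thesis
    by (intro that[of "Blinfun q"]) (simp_all add: bounded_linear_Blinfun_apply[OF bl])
qed

section \<open>The canonical embedding and almost orthogonal vectors\<close>

lemma bounded_linear_eval: "bounded_linear (\<lambda>f. blinfun_apply f x)"
  by (rule bounded_bilinear.bounded_linear_left[OF bounded_bilinear_blinfun_apply])

lemma canonical_embedding_apply: "blinfun_apply (canonical_embedding x) f = blinfun_apply f x"
  unfolding canonical_embedding_def by (simp add: bounded_linear_Blinfun_apply[OF bounded_linear_eval])

lemma linear_canonical_embedding: "linear canonical_embedding"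
  by (intro linearI blinfun_eqI)
    (simp_all add: canonical_embedding_apply blinfun.bilinear_simps)

lemma norm_canonical_embedding:
  fixes x :: "'a::real_normed_vector"
  shows "norm (canonical_embedding x) = norm x"
proof (rule antisym)
  show "norm (canonical_embedding x) \<le> norm x"
    by (rule norm_blinfun_bound) (simp_all add: canonical_embedding_apply norm_blinfun mult.commute[of "norm x"] del: real_norm_def)
  obtain f :: "'a \<Rightarrow>\<^sub>L real" where f: "norm f \<le> 1" "blinfun_apply f x = norm x"
    by (rule exists_norming_functional)
  have "norm x \<le> norm (canonical_embedding x) * norm f"
    using norm_blinfun[of "canonical_embedding x" f] f(2) by (simp add: canonical_embedding_apply)
  also have "\<dots> \<le> norm (canonical_embedding x)"
    using f(1) by (simp add: mult_left_le)
  finally show "norm x \<le> norm (canonical_embedding x)" .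
qed

text \<open>An isometric image of a complete space is complete, hence closed. This lets
  \<open>Riesz_lemma\<close> act on the range inside the bidual.\<close>

lemma closed_range_canonical_embedding:
  "closed (range (canonical_embedding :: 'a::banach \<Rightarrow> _))"
proof (rule complete_imp_closed, rule completeI)
  fix F :: "nat \<Rightarrow> ('a \<Rightarrow>\<^sub>L real) \<Rightarrow>\<^sub>L real"
  assume ran: "\<forall>n. F n \<in> range canonical_embedding" and "Cauchy F"
  then obtain x :: "nat \<Rightarrow> 'a" where F: "\<And>n. F n = canonical_embedding (x n)"
    by (auto simp: image_iff choice_iff)
  have dist: "dist (canonical_embedding u) (canonical_embedding v) = dist u v" for u v :: 'a
    by (simp add: dist_norm norm_canonical_embedding flip: linear_diff[OF linear_canonical_embedding])
  have "Cauchy x"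
    using \<open>Cauchy F\<close> by (simp add: Cauchy_def F dist)
  then obtain l where "x \<longlonglongrightarrow> l"
    using Cauchy_convergent convergent_def by blast
  then have "F \<longlonglongrightarrow> canonical_embedding l"
    by (simp add: lim_sequentially F dist)
  then show "\<exists>l\<in>range canonical_embedding. F \<longlonglongrightarrow> l"
    by blast
qed

text \<open>For y outside S choose s in S with norm (y - s) below the distance of y to S divided by
  d, and normalise y - s by its length c. For v in S the point s + c v is again in S, so the
  distance from v is a distance of y to S rescaled by 1 / c.\<close>

lemma Riesz_lemma:
  fixes S :: "'a::real_normed_vector set"
  assumes S: "closed S" "subspace S" "S \<noteq> UNIV" and d: "0 < d" "d < 1"
  obtains z where "norm z = 1" "\<And>s. s \<in> S \<Longrightarrow> d < norm (z - s)"
proof -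
  obtain y where y: "y \<notin> S"
    using S(3) by blast
  have ne: "S \<noteq> {}"
    using subspace_0[OF S(2)] by blast
  have pos: "0 < infdist y S"
    by (rule infdist_pos_not_in_closed[OF S(1) ne y])
  have "infdist y S < infdist y S / d"
    using pos d by (simp add: field_simps)
  then obtain s where s: "s \<in> S" "dist y s < infdist y S / d"
    using ne by (auto simp: infdist_notempty cINF_less_iff)
  define c where "c = norm (y - s)"
  have c: "0 < c" "d * c < infdist y S"
    using y s d by (auto simp: c_def dist_norm field_simps)
  show thesis
  proof
    show "norm ((1 / c) *\<^sub>R (y - s)) = 1"
      using c by (simp add: c_def)
    fix v assume "v \<in> S"
    then have "s + c *\<^sub>R v \<in> S"
      using s S(2) by (intro subspace_add subspace_scale)
    then have "d * c < norm (y - (s + c *\<^sub>R v))"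
      using infdist_le[of "s + c *\<^sub>R v" S y] c by (simp add: dist_norm)
    also have "y - (s + c *\<^sub>R v) = c *\<^sub>R ((1 / c) *\<^sub>R (y - s) - v)"
      using c by (simp add: algebra_simps)
    finally show "d < norm ((1 / c) *\<^sub>R (y - s) - v)"
      using c by simp
  qed
qed

lemma unit_ball_near_norming:
  fixes g :: "'a::real_normed_vector \<Rightarrow>\<^sub>L real"
  assumes "e < norm g"
  obtains x where "norm x \<le> 1" "e < blinfun_apply g x"
\<comment> \<open>A negative e is no admissible operator norm bound for
  \<open>norm_blinfun_bound\<close>; the origin settles that case.\<close>
proof (cases "e < 0")
  case True
  then show thesis
    using that[of 0] by simp
next
  case False
  have "\<not> (\<forall>x. norm (blinfun_apply g x) \<le> e * norm x)"
    using norm_blinfun_bound[of e g] assms False by force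
  then obtain x where x: "e * norm x < \<bar>blinfun_apply g x\<bar>"
    by (auto simp: not_le)
  then have "x \<noteq> 0"
    by auto
  define y where "y = (sgn (blinfun_apply g x) / norm x) *\<^sub>R x"
  have "blinfun_apply g y = \<bar>blinfun_apply g x\<bar> / norm x"
    by (simp add: y_def blinfun.scaleR_right abs_sgn mult.commute)
  moreover have "norm y \<le> 1"
    using \<open>x \<noteq> 0\<close> by (simp add: y_def abs_sgn_eq)
  ultimately show thesis
    using that[of y] x \<open>x \<noteq> 0\<close> by (simp add: pos_less_divide_eq)
qed

section \<open>Nonreflexive spaces\<close>

text \<open>Finite form of Goldstine's theorem by a variational argument. If the infimal error
  \<delta> over the ball were at least e squared, moving from a near-minimiser x towards any y of
  the ball could hardly lower the error. Then h is almost minimal at x on the ball, which forces F h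
  < - norm h and contradicts norm F <= 1.\<close>

lemma Goldstine_finite:
  fixes F :: "('a::real_normed_vector \<Rightarrow>\<^sub>L real) \<Rightarrow>\<^sub>L real"
  assumes G: "finite G" and F: "norm F \<le> 1" and e: "0 < e"
  obtains x where "norm x \<le> 1" "\<And>g. g \<in> G \<Longrightarrow> \<bar>blinfun_apply g x - blinfun_apply F g\<bar> < e"
proof -
  \<comment> \<open>A near-minimiser of the squared error \<open>\<phi>\<close> yields the separating functional \<open>h\<close>.\<close>
  define \<phi> where "\<phi> x = (\<Sum>g\<in>G. (blinfun_apply g x - blinfun_apply F g)\<^sup>2)" for x
  define \<delta> where "\<delta> = (INF x\<in>cball 0 1. \<phi> x)"
  have ne: "cball (0::'a) 1 \<noteq> {}"
    by simp
  have bdd: "bdd_below (\<phi> ` cball 0 1)"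
    by (intro bdd_belowI2[where m = 0]) (simp add: \<phi>_def sum_nonneg)
  have "\<delta> < e\<^sup>2"
  proof (rule ccontr)
    assume "\<not> \<delta> < e\<^sup>2"
    then have \<delta>: "0 < \<delta>"
      using e by (smt (verit) zero_less_power)
    define M where "M = 1 + (\<Sum>g\<in>G. (2 * norm g)\<^sup>2)"
    have M: "0 < M"
      unfolding M_def by (intro add_pos_nonneg sum_nonneg) auto
    \<comment> \<open>Step length from x towards y. \<open>M\<close> bounds the sum of the squared
      increments \<open>w g\<close>; the slack allowed to x and the second-order term are each at
      most t * t * M, so division by 2 t leaves the error t * M <= \<delta> / 2.\<close>
    define t where "t = min 1 (\<delta> / (2 * M))"
    have t: "0 < t" "t \<le> 1" "t * M \<le> \<delta> / 2"
      using M \<delta> by (auto simp: t_def min_def field_simps)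
    have "\<delta> < \<delta> + t\<^sup>2 * M"
      using t M by simp
    then have "\<exists>x\<in>cball 0 1. \<phi> x < \<delta> + t\<^sup>2 * M"
      using cINF_less_iff[OF ne bdd, of "\<delta> + t\<^sup>2 * M"] by (simp only: \<delta>_def)
    then obtain x where x: "norm x \<le> 1" "\<phi> x < \<delta> + t\<^sup>2 * M"
      by auto
    define v where "v g = blinfun_apply g x - blinfun_apply F g" for g
    define h where "h = (\<Sum>g\<in>G. v g *\<^sub>R g)"
    have h_apply: "blinfun_apply h y = (\<Sum>g\<in>G. v g * blinfun_apply g y)" for y
      by (simp add: h_def blinfun.sum_left blinfun.scaleR_left)
    have F_h: "blinfun_apply F h = (\<Sum>g\<in>G. v g * blinfun_apply F g)"
      by (simp add: h_def blinfun.sum_right blinfun.scaleR_right)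
    have "blinfun_apply h x - blinfun_apply F h = \<phi> x"
      by (simp add: h_apply F_h \<phi>_def v_def power2_eq_square algebra_simps flip: sum_subtractf)
    moreover have "\<delta> \<le> \<phi> x"
      unfolding \<delta>_def using x bdd by (intro cINF_lower) auto
    ultimately have hx: "\<delta> \<le> blinfun_apply h x - blinfun_apply F h"
      by simp
    have hy: "- \<delta> / 2 \<le> blinfun_apply h y - blinfun_apply h x" if y: "norm y \<le> 1" for y
    proof -
      define w where "w g = blinfun_apply g y - blinfun_apply g x" for g :: "'a \<Rightarrow>\<^sub>L real"
      have "\<bar>w g\<bar> \<le> \<bar>2 * norm g\<bar>" for g
      proof -
        have "\<bar>w g\<bar> \<le> norm g * norm (y - x)"
          using norm_blinfun[of g "y - x"] by (simp add: w_def blinfun.diff_right)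
        also have "\<dots> \<le> norm g * 2"
          using norm_triangle_ineq4[of y x] x y by (intro mult_left_mono) auto
        finally show ?thesis
          by simp
      qed
      then have "(\<Sum>g\<in>G. (w g)\<^sup>2) \<le> (\<Sum>g\<in>G. (2 * norm g)\<^sup>2)"
        by (intro sum_mono) (simp only: abs_le_square_iff)
      then have wM: "(\<Sum>g\<in>G. (w g)\<^sup>2) \<le> M"
        by (simp add: M_def)
      have "(1 - t) *\<^sub>R x + t *\<^sub>R y \<in> cball 0 1"
        using x y t by (intro convexD) auto
      then have "\<delta> \<le> \<phi> ((1 - t) *\<^sub>R x + t *\<^sub>R y)"
        unfolding \<delta>_def using bdd by (intro cINF_lower)
      also have "\<dots> = (\<Sum>g\<in>G. (v g + t * w g)\<^sup>2)"
        unfolding \<phi>_def v_def w_def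
        by (intro sum.cong arg_cong[where f = "\<lambda>z. z\<^sup>2"]) (simp_all add: blinfun.bilinear_simps algebra_simps)
      also have "\<dots> = \<phi> x + 2 * t * (\<Sum>g\<in>G. v g * w g) + t\<^sup>2 * (\<Sum>g\<in>G. (w g)\<^sup>2)"
        unfolding \<phi>_def v_def[symmetric]
        by (simp add: power2_sum power_mult_distrib sum.distrib sum_distrib_left mult.assoc mult.left_commute)
      also have "(\<Sum>g\<in>G. v g * w g) = blinfun_apply h y - blinfun_apply h x"
        by (simp add: h_apply w_def algebra_simps sum_subtractf)
      finally have "\<delta> \<le> \<delta> + t\<^sup>2 * M + 2 * t * (blinfun_apply h y - blinfun_apply h x) + t\<^sup>2 * M"
        using x(2) mult_left_mono[OF wM zero_le_power2[of t]] by linarith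
      then have "0 \<le> 2 * t * (t * M + (blinfun_apply h y - blinfun_apply h x))"
        by (simp add: power2_eq_square algebra_simps)
      then have "0 \<le> t * M + (blinfun_apply h y - blinfun_apply h x)"
        using t(1) by (simp add: zero_le_mult_iff)
      then show ?thesis
        using t(3) by linarith
    qed
    \<comment> \<open>Here h y < - norm h + \<delta> / 4. Together with \<open>hy\<close> and
      \<open>hx\<close> this gives F h < - norm h - \<delta> / 4.\<close>
    obtain y where y: "norm y \<le> 1" "norm h - \<delta> / 4 < blinfun_apply (- h) y"
      using unit_ball_near_norming[of "norm h - \<delta> / 4" "- h"] \<delta> by auto
    have "\<bar>blinfun_apply F h\<bar> \<le> 1 * norm h"
      using norm_blinfun[of F h] mult_right_mono[OF F, of "norm h"] by simp
    then show False
      using hy[OF y(1)] hx y(2) \<delta> by (simp add: blinfun.minus_left)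
  qed
  then obtain x where x: "norm x \<le> 1" "\<phi> x < e\<^sup>2"
    using cINF_less_iff[OF ne bdd] by (auto simp: \<delta>_def)
  show thesis
  proof (rule that[OF x(1)])
    fix g assume "g \<in> G"
    then have "(blinfun_apply g x - blinfun_apply F g)\<^sup>2 \<le> \<phi> x"
      unfolding \<phi>_def using G by (intro member_le_sum) auto
    then have "\<bar>blinfun_apply g x - blinfun_apply F g\<bar>\<^sup>2 < e\<^sup>2"
      using x(2) by simp
    then show "\<bar>blinfun_apply g x - blinfun_apply F g\<bar> < e"
      using e by (intro power2_less_imp_less[of _ e]) auto
  qed
qed

text \<open>Each c has some g in the dual ball that nearly norms F minus the image of c. The same g
  still works near c, so these open sets cover \<open>K\<close> and compactness leaves finitely many
  g.\<close>

lemma finite_separating_functionals: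
  fixes F :: "('a::real_normed_vector \<Rightarrow>\<^sub>L real) \<Rightarrow>\<^sub>L real"
  assumes K: "compact K" and far: "\<And>c. d < norm (F - canonical_embedding c)"
  obtains G where "finite G" "\<And>c. c \<in> K \<Longrightarrow> \<exists>g\<in>G. norm g \<le> 1 \<and> d < blinfun_apply F g - blinfun_apply g c"
proof -
  define U where "U g = {c. d < blinfun_apply F g - blinfun_apply g c}" for g :: "'a \<Rightarrow>\<^sub>L real"
  have "open (U g)" for g
    unfolding U_def by (intro open_Collect_less continuous_intros)
  moreover have "K \<subseteq> (\<Union>g\<in>{g. norm g \<le> 1}. U g)"
  proof
    fix c
    obtain g where "norm g \<le> 1" "d < blinfun_apply (F - canonical_embedding c) g"
      using unit_ball_near_norming[OF far[of c]] by blast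
    then show "c \<in> (\<Union>g\<in>{g. norm g \<le> 1}. U g)"
      by (auto simp: U_def blinfun.diff_left canonical_embedding_apply)
  qed
  ultimately obtain G where "G \<subseteq> {g. norm g \<le> 1}" "finite G" "K \<subseteq> (\<Union>g\<in>G. U g)"
    using compactE_image[OF K, of "{g. norm g \<le> 1}" U] by metis
  then show thesis
    by (intro that[of G]) (force simp: U_def)+
qed

lemma nonreflexive_separated_sequence:
  assumes nr: "\<not> reflexive_space TYPE('a::banach)" and d: "0 < d" "d < 1"
  obtains x :: "nat \<Rightarrow> 'a::banach" where "\<And>n. norm (x n) \<le> 1"
    "\<And>n c. c \<in> convex hull (x ` {..n}) \<Longrightarrow>
      \<exists>g :: 'a::banach \<Rightarrow>\<^sub>L real. norm g \<le> 1 \<and> (\<forall>k>n. d \<le> blinfun_apply g (x k) - blinfun_apply g c)"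
proof -
  \<comment> \<open>F stays \<theta> away from the space, and the margin \<theta> - d is spent on
    approximating F by points of the ball.\<close>
  obtain \<theta> where \<theta>: "d < \<theta>" "\<theta> < 1"
    using d dense by blast
  have "subspace (range (canonical_embedding :: 'a \<Rightarrow> _))"
    by (intro linear_subspace_image linear_canonical_embedding subspace_UNIV)
  then obtain F :: "('a \<Rightarrow>\<^sub>L real) \<Rightarrow>\<^sub>L real"
    where F: "norm F = 1" "\<And>H. H \<in> range canonical_embedding \<Longrightarrow> \<theta> < norm (F - H)"
    using Riesz_lemma[OF closed_range_canonical_embedding[where 'a = 'a]] nr d \<theta>
    unfolding reflexive_space_def by (metis order.strict_trans)
  have far: "\<theta> < norm (F - canonical_embedding c)" for c
    by (intro F(2)) auto
  \<comment> \<open>A state holds the points chosen so far, the functionals collected so far and the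
    newest point. \<open>P\<close> is the invariant of a state, \<open>Q\<close> relates consecutive
    states.\<close>
  define P where "P = (\<lambda>(S :: 'a set, G, x :: 'a). finite S \<and> finite G \<and> norm x \<le> 1 \<and>
    (\<forall>c\<in>convex hull S. \<exists>g\<in>G. norm g \<le> 1 \<and> \<theta> < blinfun_apply F g - blinfun_apply g c))"
  define Q where "Q = (\<lambda>(S :: 'a set, G, x :: 'a) (S', G', x'). S' = insert x' S \<and> G \<subseteq> G' \<and>
    (\<forall>g\<in>G. \<bar>blinfun_apply g x' - blinfun_apply F g\<bar> < \<theta> - d))"
  have ex_G: "\<exists>G. finite G \<and>
      (\<forall>c\<in>convex hull S. \<exists>g\<in>G. norm g \<le> 1 \<and> \<theta> < blinfun_apply F g - blinfun_apply g c)"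
    if "finite S" for S
    using finite_separating_functionals[OF finite_imp_compact_convex_hull[OF that] far] by metis
  have "\<exists>f. \<forall>n. (P (f n) \<and> (n = 0 \<longrightarrow> fst (f n) = {snd (snd (f n))})) \<and> Q (f n) (f (Suc n))"
  proof (rule dependent_nat_choice)
    show "\<exists>p. P p \<and> (0 = 0 \<longrightarrow> fst p = {snd (snd p)})"
    proof -
      obtain G where "finite G" "\<forall>c\<in>convex hull {0}. \<exists>g\<in>G. norm g \<le> 1 \<and> \<theta> < blinfun_apply F g - blinfun_apply g c"
        using ex_G[of "{0}"] by auto
      then show ?thesis
        by (intro exI[of _ "({0}, G, 0)"]) (simp add: P_def)
    qed
  next
    fix p and n :: nat
    assume "P p \<and> (n = 0 \<longrightarrow> fst p = {snd (snd p)})"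
    moreover obtain S G x where p: "p = (S, G, x)"
      by (cases p)
    ultimately have fin: "finite S" "finite G"
      by (auto simp: P_def)
    obtain x' where x': "norm x' \<le> 1" "\<And>g. g \<in> G \<Longrightarrow> \<bar>blinfun_apply g x' - blinfun_apply F g\<bar> < \<theta> - d"
      using Goldstine_finite[OF fin(2), of F "\<theta> - d"] F(1) \<theta>(1) by auto
    obtain G' where "finite G'"
      "\<forall>c\<in>convex hull insert x' S. \<exists>g\<in>G'. norm g \<le> 1 \<and> \<theta> < blinfun_apply F g - blinfun_apply g c"
      using ex_G[of "insert x' S"] fin by auto
    then have "P (insert x' S, G \<union> G', x') \<and> Q p (insert x' S, G \<union> G', x')"
      using fin x' by (auto simp: P_def Q_def p)
    then show "\<exists>q. (P q \<and> (Suc n = 0 \<longrightarrow> fst q = {snd (snd q)})) \<and> Q p q"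
      by blast
  qed
  then obtain f where f: "\<And>n. P (f n)" "fst (f 0) = {snd (snd (f 0))}" "\<And>n. Q (f n) (f (Suc n))"
    by blast
  define S where "S n = fst (f n)" for n
  define G where "G n = fst (snd (f n))" for n
  define x where "x n = snd (snd (f n))" for n
  have f_eq: "f n = (S n, G n, x n)" for n
    by (simp add: S_def G_def x_def)
  have PQ: "norm (x n) \<le> 1" "S (Suc n) = insert (x (Suc n)) (S n)" "G n \<subseteq> G (Suc n)"
    "g \<in> G n \<Longrightarrow> \<bar>blinfun_apply g (x (Suc n)) - blinfun_apply F g\<bar> < \<theta> - d"
    "c \<in> convex hull S n \<Longrightarrow> \<exists>g\<in>G n. norm g \<le> 1 \<and> \<theta> < blinfun_apply F g - blinfun_apply g c" for n g c
    using f(1)[of n] f(3)[of n] by (simp_all add: f_eq P_def Q_def)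
  have S_eq: "S n = x ` {..n}" for n
  proof (induction n)
    case 0
    then show ?case
      using f(2) by (simp add: S_def x_def)
  qed (simp add: PQ(2) atMost_Suc)
  have G_mono: "G m \<subseteq> G n" if "m \<le> n" for m n
    using that PQ(3) by (rule lift_Suc_mono_le[rotated])
  show thesis
  proof (rule that)
    show "norm (x n) \<le> 1" for n
      by (rule PQ(1))
    fix n c assume "c \<in> convex hull (x ` {..n})"
    then obtain g where g: "g \<in> G n" "norm g \<le> 1" "\<theta> < blinfun_apply F g - blinfun_apply g c"
      using PQ(5)[of c n] by (auto simp: S_eq)
    \<comment> \<open>The point with index \<open>Suc j\<close> was chosen against
      \<open>G j\<close>, which contains \<open>G n\<close>. So g is within \<theta> - d of
      \<open>F g\<close> there, while \<open>F g\<close> exceeds g c by more than \<theta>.\<close>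
    have "d \<le> blinfun_apply g (x k) - blinfun_apply g c" if "n < k" for k
    proof -
      obtain j where "k = Suc j" "n \<le> j"
        using \<open>n < k\<close> by (cases k) auto
      then show ?thesis
        using PQ(4)[of g j] G_mono[of n j] g by fastforce
    qed
    then show "\<exists>g. norm g \<le> 1 \<and> (\<forall>k>n. d \<le> blinfun_apply g (x k) - blinfun_apply g c)"
      using g(2) by blast
  qed
qed

section \<open>The lower bound for nonreflexive spaces\<close>

lemma normed_carrier_UNIV: "normed_carrier (UNIV :: 'a::real_normed_vector set) norm"
  by unfold_locales (auto simp: norm_triangle_ineq)

lemma unit_ball_UNIV: "unit_ball (UNIV :: 'a::real_normed_vector set) norm = cball 0 1"
  by (auto simp: unit_ball_def)

lemma cesaro_in_convex_hull: "cesaro x n \<in> convex hull (x ` {..n})"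
proof -
  have "(\<Sum>i\<le>n. (1 / real (Suc n)) *\<^sub>R x i) \<in> convex hull (x ` {..n})"
    by (intro convex_sum) (auto intro: hull_inc)
  then show ?thesis
    by (simp add: cesaro_def scaleR_sum_right)
qed

text \<open>A mean c_m of a subsequence lies in the hull of the terms up to index r m, so a single
  functional g puts all later terms at least d above it. Averaging through
  \<open>cesaro_split\<close> gives the gap required for \<open>cca_tilde >= d\<close>.\<close>

lemma nonreflexive_bs_ge_1:
  assumes "\<not> reflexive_space TYPE('a::banach)"
  shows "1 \<le> bs norm (cball (0::'a::banach) 1)"
proof (rule dense_le_bounded[of 0])
  interpret normed_carrier "UNIV :: 'a set" norm
    by (rule normed_carrier_UNIV)
  fix d :: real assume d: "0 < d" "d < 1"
  obtain x :: "nat \<Rightarrow> 'a" where x: "\<And>n. norm (x n) \<le> 1" and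
    sep: "\<And>n c. c \<in> convex hull (x ` {..n}) \<Longrightarrow>
      \<exists>g :: 'a \<Rightarrow>\<^sub>L real. norm g \<le> 1 \<and> (\<forall>k>n. d \<le> blinfun_apply g (x k) - blinfun_apply g c)"
    using nonreflexive_separated_sequence[OF assms d] by blast
  have ran: "range x \<subseteq> unit_ball UNIV norm"
    using x by (auto simp: unit_ball_def)
  have "d \<le> cca_tilde norm x"
  proof (rule cca_tilde_ge_of_cesaro_gap[OF ran])
    fix r :: "nat \<Rightarrow> nat" and m n :: nat
    assume r: "strict_mono r" and mn: "m < n"
    define c where "c = cesaro (x \<circ> r) m"
    have "(x \<circ> r) ` {..m} \<subseteq> x ` {..r m}"
      using r by (auto simp: strict_mono_less_eq)
    then have "c \<in> convex hull (x ` {..r m})"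
      unfolding c_def using cesaro_in_convex_hull[of "x \<circ> r" m] hull_mono by blast
    then obtain g :: "'a \<Rightarrow>\<^sub>L real" where g: "norm g \<le> 1"
      "\<And>k. r m < k \<Longrightarrow> d \<le> blinfun_apply g (x k) - blinfun_apply g c"
      using sep by blast
    have "d * (real (n - m) / real (Suc n)) = (\<Sum>j\<in>{m<..n}. d) / real (Suc n)"
      by simp
    also have "\<dots> \<le> (\<Sum>j\<in>{m<..n}. blinfun_apply g (x (r j)) - blinfun_apply g c) / real (Suc n)"
      using g(2) r by (intro divide_right_mono sum_mono) (auto simp: strict_mono_less)
    also have "\<dots> = - blinfun_apply g (c - cesaro (x \<circ> r) n)"
      unfolding c_def cesaro_split[OF mn]
      by (simp add: blinfun.bilinear_simps blinfun.sum_right sum_subtractf diff_divide_distrib)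
    also have "\<dots> \<le> norm g * norm (c - cesaro (x \<circ> r) n)"
      using norm_blinfun[of g "c - cesaro (x \<circ> r) n"] by simp
    also have "\<dots> \<le> norm (c - cesaro (x \<circ> r) n)"
      using g(1) by (simp add: mult_left_le_one_le)
    finally show "d * (real (n - m) / real (Suc n)) \<le> norm (cesaro (x \<circ> r) m - cesaro (x \<circ> r) n)"
      by (simp add: c_def)
  qed
  then show "d \<le> bs norm (cball (0::'a) 1)"
    using bs_ge[OF ran] by (simp add: unit_ball_UNIV)
qed simp

section \<open>Sequence spaces and gliding humps\<close>

lemma fun_sum_apply: "(\<Sum>i\<in>I. f i) x = (\<Sum>i\<in>I. f i x)" for f :: "'i \<Rightarrow> 'a \<Rightarrow> 'b::comm_monoid_add"
  by (induction I rule: infinite_finite_induct) auto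

lemma fun_scaleR_apply: "(a *\<^sub>R f) x = a *\<^sub>R f x" for f :: "'a \<Rightarrow> 'b::real_vector"
  by (simp add: scaleR_fun_def)

lemma cesaro_apply: "cesaro x k i = (\<Sum>j\<le>k. x j i) / real (Suc k)"
  for x :: "nat \<Rightarrow> nat \<Rightarrow> real"
  by (simp add: cesaro_def fun_scaleR_apply fun_sum_apply)

lemma normed_carrier_l1: "normed_carrier l1 l1_norm"
proof
  have add: "x + y \<in> l1" if "x \<in> l1" "y \<in> l1" for x y
  proof -
    have "summable (\<lambda>n. \<bar>x n\<bar> + \<bar>y n\<bar>)"
      using that by (intro summable_add) (simp_all add: l1_def)
    then show ?thesis
      unfolding l1_def by (auto intro: summable_comparison_test'[where N = 0])
  qed
  show "subspace l1"
    unfolding subspace_def using add by (auto simp: l1_def fun_scaleR_apply abs_mult summable_mult)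
  show "l1_norm (x + y) \<le> l1_norm x + l1_norm y" if "x \<in> l1" "y \<in> l1" for x y
  proof -
    have "l1_norm (x + y) \<le> (\<Sum>n. \<bar>x n\<bar> + \<bar>y n\<bar>)"
      unfolding l1_norm_def using add[OF that] that
      by (intro suminf_le) (auto simp: l1_def intro: summable_add)
    also have "\<dots> = l1_norm x + l1_norm y"
      using that by (simp add: l1_def l1_norm_def suminf_add)
    finally show ?thesis .
  qed
  show "l1_norm (a *\<^sub>R x) = \<bar>a\<bar> * l1_norm x" if "x \<in> l1" for x a
    using that unfolding l1_def l1_norm_def by (simp add: fun_scaleR_apply abs_mult suminf_mult)
qed

lemma c0_subset_c_conv: "c0 \<subseteq> c_conv"
  by (auto simp: c0_def c_conv_def convergent_def)

lemma bdd_above_c_conv: "x \<in> c_conv \<Longrightarrow> bdd_above (range (\<lambda>n. \<bar>x n\<bar>))"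
  unfolding c_conv_def using convergent_imp_Bseq[of x] by (auto simp: Bseq_def bdd_above_def)

lemma abs_le_sup_norm: "x \<in> c_conv \<Longrightarrow> \<bar>x n\<bar> \<le> sup_norm x"
  unfolding sup_norm_def by (intro cSUP_upper bdd_above_c_conv) auto

lemma sup_norm_le: "(\<And>n. \<bar>x n\<bar> \<le> b) \<Longrightarrow> sup_norm x \<le> b"
  unfolding sup_norm_def by (intro cSUP_least) auto

lemma subspace_c_conv: "subspace c_conv"
proof -
  have "0 \<in> c_conv"
    by (simp add: c_conv_def zero_fun_def convergent_const)
  moreover have "x + y \<in> c_conv" if "x \<in> c_conv" "y \<in> c_conv" for x y
    using that by (simp add: c_conv_def plus_fun_def convergent_add)
  moreover have "a *\<^sub>R x \<in> c_conv" if "x \<in> c_conv" for x a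
    using that tendsto_scaleR[OF tendsto_const] unfolding c_conv_def convergent_def scaleR_fun_def by blast
  ultimately show ?thesis
    by (simp add: subspace_def)
qed

lemma subspace_c0: "subspace c0"
proof -
  have "0 \<in> c0"
    by (simp add: c0_def zero_fun_def)
  moreover have "x + y \<in> c0" if "x \<in> c0" "y \<in> c0" for x y
    using that tendsto_add[of x 0 sequentially y 0] by (simp add: c0_def plus_fun_def)
  moreover have "a *\<^sub>R x \<in> c0" if "x \<in> c0" for x a
    using that unfolding c0_def by (auto simp: scaleR_fun_def intro: tendsto_mult_right_zero)
  ultimately show ?thesis
    by (simp add: subspace_def)
qed

lemma sup_norm_scaleR:
  assumes "x \<in> c_conv"
  shows "sup_norm (a *\<^sub>R x) = \<bar>a\<bar> * sup_norm x"
proof (rule antisym)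
  have le: "sup_norm (b *\<^sub>R y) \<le> \<bar>b\<bar> * sup_norm y" if "y \<in> c_conv" for b y
    using abs_le_sup_norm[OF that]
    by (intro sup_norm_le) (simp add: fun_scaleR_apply abs_mult mult_left_mono)
  then show "sup_norm (a *\<^sub>R x) \<le> \<bar>a\<bar> * sup_norm x"
    using assms .
  show "\<bar>a\<bar> * sup_norm x \<le> sup_norm (a *\<^sub>R x)"
  proof (cases "a = 0")
    case True
    then show ?thesis
      using abs_le_sup_norm[OF subspace_0[OF subspace_c_conv], of 0] by simp
  next
    case False
    then show ?thesis
      using le[of "a *\<^sub>R x" "1 / a"] subspace_scale[OF subspace_c_conv assms, of a]
      by (simp add: field_simps)
  qed
qed

lemma sup_norm_triangle: "x \<in> c_conv \<Longrightarrow> y \<in> c_conv \<Longrightarrow> sup_norm (x + y) \<le> sup_norm x + sup_norm y"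
  by (intro sup_norm_le) (auto intro!: order_trans[OF abs_triangle_ineq] add_mono abs_le_sup_norm)

lemma normed_carrier_c_conv: "normed_carrier c_conv sup_norm"
  by (simp add: normed_carrier_def subspace_c_conv sup_norm_triangle sup_norm_scaleR)

lemma normed_carrier_c0: "normed_carrier c0 sup_norm"
  using c0_subset_c_conv
  by (auto simp: normed_carrier_def subspace_c0 intro!: sup_norm_triangle sup_norm_scaleR)

lemma sup_norm_nonneg: "x \<in> c_conv \<Longrightarrow> 0 \<le> sup_norm x"
  by (rule normed_carrier.N_nonneg[OF normed_carrier_c_conv])

text \<open>Selection scheme of all hump arguments below. \<open>A j n k\<close> says that vector k
  behaves well on the coordinates below n, \<open>B j k m\<close> that its part from m on is
  negligible. Choosing s 0, r 0, s 1, r 1, ... in turn concentrates vector r j on the block from s j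
  to s (Suc j).\<close>

lemma gliding_hump:
  fixes A :: "nat \<Rightarrow> nat \<Rightarrow> nat \<Rightarrow> bool" and B :: "nat \<Rightarrow> nat \<Rightarrow> nat \<Rightarrow> bool"
  assumes A: "\<And>j n. \<exists>\<^sub>F k in sequentially. A j n k"
    and B: "\<And>j k. \<forall>\<^sub>F m in sequentially. B j k m"
  obtains r s where "strict_mono r" "strict_mono s" "s 0 = 0"
    "\<And>j. A j (s j) (r j)" "\<And>j. B j (r j) (s (Suc j))"
proof -
  define Q where "Q j p q \<longleftrightarrow> fst p < fst q \<and> snd p < snd q \<and> B j (snd p) (fst q)" for j and p q :: "nat \<times> nat"
  have ex: "\<exists>k>K. A j n k" for j n K
    using frequently_eventually_frequently[OF A eventually_gt_at_top[of K], of j n]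
    by (auto dest!: frequently_ex)
  \<comment> \<open>The pair f j is (s j, r j). The clause for j = 0 starts the blocks at 0, so that
    they cover all coordinates.\<close>
  have "\<exists>f. \<forall>j. (A j (fst (f j)) (snd (f j)) \<and> (j = 0 \<longrightarrow> fst (f j) = 0)) \<and> Q j (f j) (f (Suc j))"
  proof (rule dependent_nat_choice)
    show "\<exists>p. A 0 (fst p) (snd p) \<and> (0 = 0 \<longrightarrow> fst p = (0::nat))"
      using ex[of 0 0 0] by auto
  next
    fix p j
    have "\<forall>\<^sub>F m in sequentially. fst p < m \<and> B j (snd p) m"
      using eventually_gt_at_top[of "fst p"] B[of j "snd p"] by eventually_elim auto
    then obtain m where "fst p < m" "B j (snd p) m"
      using eventually_happens' sequentially_bot by blast
    moreover obtain k where "snd p < k" "A (Suc j) m k"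
      using ex by blast
    ultimately show "\<exists>q. (A (Suc j) (fst q) (snd q) \<and> (Suc j = 0 \<longrightarrow> fst q = 0)) \<and> Q j p q"
      by (intro exI[of _ "(m, k)"]) (simp add: Q_def)
  qed
  then obtain f where f: "\<And>j. A j (fst (f j)) (snd (f j))" "fst (f 0) = 0" "\<And>j. Q j (f j) (f (Suc j))"
    by blast
  then show thesis
    by (intro that[of "\<lambda>j. snd (f j)" "\<lambda>j. fst (f j)"]) (auto simp: strict_mono_Suc_iff Q_def)
qed

lemma strict_mono_block:
  fixes s :: "nat \<Rightarrow> nat"
  assumes s: "strict_mono s" "s 0 = 0"
  obtains p where "s p \<le> i" "i < s (Suc p)"
proof -
  define p where "p = (LEAST p. i < s (Suc p))"
  have "i < s (Suc i)"
    using strict_mono_imp_increasing[OF s(1), of "Suc i"] by simp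
  then have p: "i < s (Suc p)"
    unfolding p_def by (rule LeastI)
  have "s p \<le> i"
  proof (cases p)
    case (Suc q)
    then have "\<not> i < s (Suc q)"
      using not_less_Least[of q "\<lambda>p. i < s (Suc p)"] by (simp add: p_def)
    then show ?thesis
      by (simp add: Suc)
  qed (simp add: s)
  with p show thesis
    by (rule that[rotated])
qed

lemma sum_half_powers_le: "(\<Sum>j\<in>J. (1 / 2 :: real) ^ j) \<le> 2"
\<comment> \<open>For infinite \<open>J\<close> the sum is 0 by convention.\<close>
proof (cases "finite J")
  case True
  then have "(\<Sum>j\<in>J. (1 / 2 :: real) ^ j) \<le> (\<Sum>j. (1 / 2) ^ j)"
    by (intro sum_le_suminf summable_geometric) auto
  then show ?thesis
    by (simp add: suminf_geometric)
qed simp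

text \<open>At a coordinate i the subsequence is nearly 0 before the block containing i and nearly x
  i after it. The one term of that block costs at most b and the remaining errors sum to at most 2,
  whence (b + 2) / (n + 1). The null sequence \<open>t\<close> is carried along to become summable
  on the same subsequence.\<close>

lemma c0_subseq_cesaro:
  fixes z :: "nat \<Rightarrow> nat \<Rightarrow> real"
  assumes z: "\<And>k. z k \<in> c0" and bdd: "\<And>k i. \<bar>z k i\<bar> \<le> b"
    and lim: "\<And>i. (\<lambda>k. z k i) \<longlonglongrightarrow> x i" and t: "t \<longlonglongrightarrow> (0::real)"
  obtains r where "strict_mono r" "\<And>j. \<bar>t (r j)\<bar> \<le> (1 / 2) ^ j"
    "\<And>n i. \<exists>\<alpha>. 0 \<le> \<alpha> \<and> \<alpha> \<le> 1 \<and> \<bar>cesaro (z \<circ> r) n i - \<alpha> * x i\<bar> \<le> (b + 2) / real (Suc n)"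
proof -
  have pos: "(0::real) < (1 / 2) ^ j" for j :: nat
    by simp
  have A: "\<exists>\<^sub>F k in sequentially. (\<forall>i\<in>{..<n}. \<bar>z k i - x i\<bar> < (1 / 2) ^ j) \<and> \<bar>t k\<bar> < (1 / 2) ^ j" for j n
  proof (rule eventually_frequently[OF sequentially_bot], rule eventually_conj)
    have "\<forall>\<^sub>F k in sequentially. \<bar>z k i - x i\<bar> < (1 / 2) ^ j" for i
      using tendstoD[OF lim pos] by (simp add: dist_real_def)
    then show "\<forall>\<^sub>F k in sequentially. \<forall>i\<in>{..<n}. \<bar>z k i - x i\<bar> < (1 / 2) ^ j"
      by (intro eventually_ball_finite) auto
    show "\<forall>\<^sub>F k in sequentially. \<bar>t k\<bar> < (1 / 2) ^ j"
      using tendstoD[OF t pos] by (simp add: dist_real_def)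
  qed
  have B: "\<forall>\<^sub>F m in sequentially. \<forall>i\<ge>m. \<bar>z k i\<bar> < (1 / 2) ^ j" for j k
  proof -
    have "\<forall>\<^sub>F i in sequentially. \<bar>z k i\<bar> < (1 / 2) ^ j"
      using tendstoD[of "z k" 0 sequentially, OF _ pos] z[of k] by (simp add: c0_def)
    then show ?thesis
      by (simp add: eventually_all_ge_at_top)
  qed
  obtain r s where r: "strict_mono r" and s: "strict_mono s" "s 0 = 0"
    and close: "\<And>j. (\<forall>i\<in>{..<s j}. \<bar>z (r j) i - x i\<bar> < (1 / 2) ^ j) \<and> \<bar>t (r j)\<bar> < (1 / 2) ^ j"
    and small: "\<And>j. \<forall>i\<ge>s (Suc j). \<bar>z (r j) i\<bar> < (1 / 2) ^ j"
    using gliding_hump[of "\<lambda>j n k. (\<forall>i\<in>{..<n}. \<bar>z k i - x i\<bar> < (1 / 2) ^ j) \<and> \<bar>t k\<bar> < (1 / 2) ^ j"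
        "\<lambda>j k m. \<forall>i\<ge>m. \<bar>z k i\<bar> < (1 / 2) ^ j", OF A B] by blast
  show thesis
  proof (rule that[OF r])
    show "\<bar>t (r j)\<bar> \<le> (1 / 2) ^ j" for j
      using close[of j] by simp
    fix n i
    obtain p where p: "s p \<le> i" "i < s (Suc p)"
      by (rule strict_mono_block[OF s])
    \<comment> \<open>The terms before the block of \<open>i\<close> are small there, those after it are close to the limit.\<close>
    define y where "y j = (if p < j then x i else 0)" for j
    have err: "\<bar>z (r j) i - y j\<bar> \<le> (if j = p then b else 0) + (1 / 2) ^ j" for j
    proof (cases j p rule: linorder_cases)
      case less
      then have "s (Suc j) \<le> i"
        using p(1) strict_mono_leD[OF s(1), of "Suc j" p] by simp
      then show ?thesis
        using small[of j] less by (auto simp: y_def intro: less_imp_le)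
    next
      case equal
      have "\<bar>z (r j) i\<bar> \<le> b + (1 / 2) ^ j"
        using bdd[of "r j" i] pos[of j] by linarith
      with equal show ?thesis
        by (simp add: y_def)
    next
      case greater
      then have "i < s j"
        using p(2) strict_mono_leD[OF s(1), of "Suc p" j] by simp
      then show ?thesis
        using close[of j] greater by (auto simp: y_def intro: less_imp_le)
    qed
    have b: "0 \<le> b"
      using bdd[of 0 0] by simp
    have "\<bar>(\<Sum>j\<le>n. z (r j) i) - (\<Sum>j\<le>n. y j)\<bar> \<le> (\<Sum>j\<le>n. \<bar>z (r j) i - y j\<bar>)"
      by (simp add: sum_abs flip: sum_subtractf)
    also have "\<dots> \<le> (\<Sum>j\<le>n. if j = p then b else 0) + (\<Sum>j\<le>n. (1 / 2) ^ j)"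
      using err by (subst sum.distrib[symmetric]) (rule sum_mono)
    also have "\<dots> \<le> b + 2"
      using b by (intro add_mono sum_half_powers_le) simp
    finally have sums: "\<bar>(\<Sum>j\<le>n. z (r j) i) - (\<Sum>j\<le>n. y j)\<bar> \<le> b + 2" .
    \<comment> \<open>The proportion of the first n + 1 terms that come after the block of
      i.\<close>
    define \<alpha> where "\<alpha> = real (card {j\<in>{..n}. p < j}) / real (Suc n)"
    have "card {j\<in>{..n}. p < j} \<le> card {..n}"
      by (intro card_mono) auto
    then have "0 \<le> \<alpha>" "\<alpha> \<le> 1"
      by (simp_all add: \<alpha>_def)
    moreover have "(\<Sum>j\<le>n. y j) = real (card {j\<in>{..n}. p < j}) * x i"
      by (simp add: y_def flip: sum.inter_filter)
    then have "cesaro (z \<circ> r) n i - \<alpha> * x i = ((\<Sum>j\<le>n. z (r j) i) - (\<Sum>j\<le>n. y j)) / real (Suc n)"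
      by (simp add: cesaro_apply \<alpha>_def diff_divide_distrib)
    then have "\<bar>cesaro (z \<circ> r) n i - \<alpha> * x i\<bar> \<le> (b + 2) / real (Suc n)"
      using sums by (simp add: abs_divide divide_right_mono)
    ultimately show "\<exists>\<alpha>. 0 \<le> \<alpha> \<and> \<alpha> \<le> 1 \<and> \<bar>cesaro (z \<circ> r) n i - \<alpha> * x i\<bar> \<le> (b + 2) / real (Suc n)"
      by blast
  qed
qed

text \<open>Bolzano-Weierstrass in each coordinate followed by diagonalisation.\<close>

lemma pointwise_convergent_subsequence:
  fixes z :: "nat \<Rightarrow> nat \<Rightarrow> real"
  assumes bdd: "\<And>k i. \<bar>z k i\<bar> \<le> b"
  obtains r x where "strict_mono r" "\<And>i. (\<lambda>k. z (r k) i) \<longlonglongrightarrow> x i" "\<And>i. \<bar>x i\<bar> \<le> b"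
proof -
  interpret subseqs "\<lambda>i s. convergent (\<lambda>k. z (s k) i)"
  proof
    fix i and s :: "nat \<Rightarrow> nat"
    have "bounded (range (\<lambda>k. z (s k) i))"
      using bdd by (auto simp: bounded_iff)
    then obtain l r where "strict_mono r" "((\<lambda>k. z (s k) i) \<circ> r) \<longlonglongrightarrow> l"
      using bounded_imp_convergent_subsequence by blast
    then show "\<exists>r. strict_mono r \<and> convergent (\<lambda>k. z ((s \<circ> r) k) i)"
      by (auto simp: convergent_def o_def)
  qed
  have "convergent (\<lambda>k. z (diagseq k) i)" for i
  proof -
    \<comment> \<open>From index Suc i on, the diagonal sequence is a subsequence of one along which
      coordinate i converges.\<close>
    have "convergent (\<lambda>k. z ((diagseq \<circ> ((+) (Suc i))) k) i)"
    proof (rule diagseq_holds)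
      show "convergent (\<lambda>k. z ((s \<circ> r) k) n)" if "strict_mono r" "convergent (\<lambda>k. z (s k) n)" for r s n
        using convergent_subseq_convergent[OF that(2,1)] by (simp add: o_def)
    qed
    then have "convergent (\<lambda>k. z (diagseq (k + Suc i)) i)"
      by (simp add: o_def add.commute)
    then show ?thesis
      using convergent_ignore_initial_segment[of "\<lambda>k. z (diagseq k) i" "Suc i"] by simp
  qed
  then have x: "(\<lambda>k. z (diagseq k) i) \<longlonglongrightarrow> lim (\<lambda>k. z (diagseq k) i)" for i
    by (simp add: convergent_LIMSEQ_iff)
  moreover have "\<bar>lim (\<lambda>k. z (diagseq k) i)\<bar> \<le> b" for i
    by (rule LIMSEQ_le_const2[OF tendsto_rabs[OF x]]) (use bdd in auto)
  ultimately show thesis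
    by (rule that[OF subseq_diagseq])
qed

section \<open>Copies of \<open>\<ell>\<^sub>1\<close>\<close>

text \<open>At most one summand is nonzero, so nothing can cancel.\<close>

lemma abs_sum_disjoint:
  fixes f :: "'i \<Rightarrow> real"
  assumes "\<And>j k. j \<in> I \<Longrightarrow> k \<in> I \<Longrightarrow> j \<noteq> k \<Longrightarrow> f j = 0 \<or> f k = 0"
  shows "\<bar>\<Sum>j\<in>I. f j\<bar> = (\<Sum>j\<in>I. \<bar>f j\<bar>)"
  using assms
proof (induction I rule: infinite_finite_induct)
  case (insert k I)
  have IH: "\<bar>\<Sum>j\<in>I. f j\<bar> = (\<Sum>j\<in>I. \<bar>f j\<bar>)"
    using insert.prems by (intro insert.IH) blast
  show ?case
  proof (cases "f k = 0")
    case False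
    then have "f j = 0" if "j \<in> I" for j
      using insert.prems[of j k] insert.hyps that by auto
    then show ?thesis
      using insert.hyps by simp
  qed (simp add: insert.hyps IH)
qed simp_all

lemma finite_support_in_l1:
  assumes "\<And>i. M \<le> i \<Longrightarrow> a i = 0"
  shows "a \<in> l1"
proof -
  have "summable (\<lambda>i. \<bar>a i\<bar>)"
    using assms by (intro summable_finite[of "{..<M}"]) auto
  then show ?thesis
    by (simp add: l1_def)
qed

lemma l1_norm_disjoint_sum:
  fixes b :: "'j \<Rightarrow> nat \<Rightarrow> real"
  assumes b: "\<And>j. j \<in> J \<Longrightarrow> b j \<in> l1" "\<And>j. j \<in> J \<Longrightarrow> l1_norm (b j) = 1"
    and disj: "\<And>i j k. j \<in> J \<Longrightarrow> k \<in> J \<Longrightarrow> j \<noteq> k \<Longrightarrow> b j i = 0 \<or> b k i = 0"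
  shows "l1_norm (\<Sum>j\<in>J. \<beta> j *\<^sub>R b j) = (\<Sum>j\<in>J. \<bar>\<beta> j\<bar>)"
proof -
  have "\<bar>(\<Sum>j\<in>J. \<beta> j *\<^sub>R b j) i\<bar> = (\<Sum>j\<in>J. \<bar>\<beta> j\<bar> * \<bar>b j i\<bar>)" for i
    unfolding fun_sum_apply fun_scaleR_apply
    by (subst abs_sum_disjoint) (use disj in \<open>force simp: abs_mult\<close>)+
  then have "l1_norm (\<Sum>j\<in>J. \<beta> j *\<^sub>R b j) = (\<Sum>i. \<Sum>j\<in>J. \<bar>\<beta> j\<bar> * \<bar>b j i\<bar>)"
    by (simp add: l1_norm_def)
  also have "\<dots> = (\<Sum>j\<in>J. \<Sum>i. \<bar>\<beta> j\<bar> * \<bar>b j i\<bar>)"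
    using b(1) by (intro suminf_sum summable_mult) (simp add: l1_def)
  also have "\<dots> = (\<Sum>j\<in>J. \<bar>\<beta> j\<bar>)"
    using b by (intro sum.cong refl) (simp add: l1_def l1_norm_def suminf_mult)
  finally show ?thesis .
qed

context normed_carrier
begin

text \<open>\<open>lam n\<close> is the best lower bound of T on unit vectors of finite support
  beyond n, and \<open>L\<close> is the supremum of these bounds. Beyond a suitable n0 the lower
  bound is almost \<open>L\<close>, while every tail still contains a unit vector whose image has
  norm hardly above \<open>L\<close>. Disjoint blocks of such vectors, normalised, are almost
  isometric to the l1 basis.\<close>

lemma James_distortion:
  assumes l1: "contains_l1_copy V N" and d: "0 < d" "d < 1"
  obtains x where "range x \<subseteq> unit_ball V N"
    "\<And>(r :: nat \<Rightarrow> nat) \<beta> n. strict_mono r \<Longrightarrow> d * (\<Sum>j\<le>n. \<bar>\<beta> j\<bar>) \<le> N (\<Sum>j\<le>n. \<beta> j *\<^sub>R x (r j))"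
proof -
  obtain T c C where TV: "\<And>a. a \<in> l1 \<Longrightarrow> T a \<in> V"
    and T_lin: "\<And>a b s t. a \<in> l1 \<Longrightarrow> b \<in> l1 \<Longrightarrow> T (s *\<^sub>R a + t *\<^sub>R b) = s *\<^sub>R T a + t *\<^sub>R T b"
    and c: "0 < c" and T_ge: "\<And>a. a \<in> l1 \<Longrightarrow> c * l1_norm a \<le> N (T a)"
    and T_le: "\<And>a. a \<in> l1 \<Longrightarrow> N (T a) \<le> C * l1_norm a"
    using l1 unfolding contains_l1_copy_def by blast
  interpret l1: normed_carrier l1 l1_norm
    by (rule normed_carrier_l1)
  have T_scale: "T (s *\<^sub>R a) = s *\<^sub>R T a" if "a \<in> l1" for s a
    using T_lin[OF that that, of s 0] by simp
  have T_sum: "T (\<Sum>j\<in>J. \<beta> j *\<^sub>R b j) = (\<Sum>j\<in>J. \<beta> j *\<^sub>R T (b j))"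
    if "\<And>j. b j \<in> l1" for J :: "nat set" and \<beta> and b :: "nat \<Rightarrow> nat \<Rightarrow> real"
  proof (induction J rule: infinite_finite_induct)
    case (insert j J)
    have "(\<Sum>j\<in>J. \<beta> j *\<^sub>R b j) \<in> l1"
      using that by (intro subspace_sum[OF l1.subspace_V] subspace_scale[OF l1.subspace_V])
    then have "T (\<beta> j *\<^sub>R b j + (\<Sum>j\<in>J. \<beta> j *\<^sub>R b j)) = \<beta> j *\<^sub>R T (b j) + T (\<Sum>j\<in>J. \<beta> j *\<^sub>R b j)"
      using T_lin[OF that[of j], of _ "\<beta> j" 1] by simp
    then show ?case
      unfolding sum.insert[OF insert.hyps] insert.IH .
  qed (use T_scale[of 0 0] subspace_0[OF l1.subspace_V] in \<open>simp_all add: zero_fun_def\<close>)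

  \<comment> \<open>Finite support lets the next block start behind the previous one.\<close>
  define D where "D n = {a. l1_norm a = 1 \<and> (\<exists>M. \<forall>i. i < n \<or> M \<le> i \<longrightarrow> a i = 0)}" for n :: nat
  have D_l1: "D n \<subseteq> l1" for n
    by (auto simp: D_def intro: finite_support_in_l1)
  have D_ne: "(\<lambda>i. if i = n then 1 else 0) \<in> D n" for n
  proof -
    have "l1_norm (\<lambda>i. if i = n then 1 else 0) = 1"
      using suminf_finite[of "{n}" "\<lambda>i. \<bar>if i = n then 1 else 0 :: real\<bar>"] by (simp add: l1_norm_def)
    then show ?thesis
      by (auto simp: D_def intro!: exI[of _ "Suc n"])
  qed
  have D_bounds: "c \<le> N (T a)" "N (T a) \<le> C" if "a \<in> D n" for a n
    using T_ge[of a] T_le[of a] that D_l1[of n] by (auto simp: D_def)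
  define lam where "lam n = (INF a\<in>D n. N (T a))" for n
  have D_bdd: "bdd_below ((\<lambda>a. N (T a)) ` D n)" for n
    using D_bounds(1) by (intro bdd_belowI2)
  have lam_le: "lam n \<le> N (T a)" if "a \<in> D n" for a n
    unfolding lam_def using that D_bdd by (intro cINF_lower)
  have lam_ge: "c \<le> lam n" for n
    unfolding lam_def using D_ne[of n] D_bounds(1) by (intro cINF_greatest) auto
  have lam_bdd: "bdd_above (range lam)"
    using lam_le[OF D_ne] D_bounds(2)[OF D_ne] by (intro bdd_aboveI2[where M = C]) (rule order_trans)
  define L where "L = (SUP n. lam n)"
  have lam_le_L: "lam n \<le> L" for n
    unfolding L_def by (intro cSUP_upper lam_bdd) auto
  have L: "0 < L"
    using lam_ge[of 0] lam_le_L[of 0] c by linarith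
  \<comment> \<open>Any q strictly between 1 and 1 / d would serve: blocks have norm below q * L,
    combinations have norm at least d * q * L times the sum of the absolute coefficients, and
    dividing by q * L leaves d.\<close>
  define q where "q = 2 / (1 + d)"
  have q: "1 < q" "d * q < 1"
    using d by (simp_all add: q_def field_simps)
  have "d * q * L < L"
    using q L by simp
  then obtain n0 where n0: "d * q * L < lam n0"
    unfolding L_def using less_cSUP_iff[OF _ lam_bdd] by auto
  have "\<exists>a\<in>D m. N (T a) < q * L" for m
  proof -
    have "lam m < q * L"
      using lam_le_L[of m] q L by (metis le_less_trans mult_strict_right_mono mult_1)
    then show ?thesis
      unfolding lam_def using cINF_less_iff[OF _ D_bdd] D_ne by blast
  qed
  then have "\<forall>m. \<exists>a M. a \<in> D m \<and> (\<forall>i. i < m \<or> M \<le> i \<longrightarrow> a i = 0) \<and> N (T a) < q * L"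
    unfolding D_def by blast
  then obtain a M where a: "\<And>m. a m \<in> D m" "\<And>m i. i < m \<or> M m \<le> i \<Longrightarrow> a m i = 0"
      "\<And>m. N (T (a m)) < q * L"
    by metis
  \<comment> \<open>Block boundaries: the vector chosen at s j vanishes before s j and from s (Suc
    j) on. Starting at n0 keeps all combinations inside the reach of \<open>lam n0\<close>.\<close>
  define s where "s = rec_nat n0 (\<lambda>_ m. max m (M m))"
  have s: "s 0 = n0" "s (Suc j) = max (s j) (M (s j))" for j
    by (simp_all add: s_def)
  have s_mono: "s j \<le> s k" if "j \<le> k" for j k
    using that by (rule lift_Suc_mono_le[rotated]) (simp add: s)
  define b where "b j = a (s j)" for j
  have b_supp: "s j \<le> i \<and> i < s (Suc j)" if "b j i \<noteq> 0" for j i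
    using that a(2)[of i "s j"] unfolding b_def s by linarith
  have b_l1: "b j \<in> l1" and b_norm: "l1_norm (b j) = 1" for j
    using a(1)[of "s j"] D_l1 by (auto simp: b_def D_def)
  have b_disj: "b j i = 0 \<or> b k i = 0" if "j \<noteq> k" for j k i
  proof (rule ccontr)
    assume "\<not> ?thesis"
    then have "i < s (Suc j)" "s j \<le> i" "i < s (Suc k)" "s k \<le> i"
      using b_supp by blast+
    moreover have "s (Suc j) \<le> s k \<or> s (Suc k) \<le> s j"
      using that s_mono[of "Suc j" k] s_mono[of "Suc k" j] by linarith
    ultimately show False
      by linarith
  qed

  define x where "x j = (1 / (q * L)) *\<^sub>R T (b j)" for j
  have qL: "0 < q * L"
    using q L by simp
  show thesis
  proof (rule that)
    have "x j \<in> unit_ball V N" for j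
      using a(3)[of "s j"] qL TV[OF b_l1[of j]] subspace_scale[OF subspace_V TV[OF b_l1[of j]]]
      by (simp add: unit_ball_def x_def N_scaleR b_def pos_divide_le_eq)
    then show "range x \<subseteq> unit_ball V N"
      by blast
    fix r :: "nat \<Rightarrow> nat" and \<beta> n assume r: "strict_mono r"
    define v where "v = (\<Sum>j\<le>n. \<beta> j *\<^sub>R b (r j))"
    define S where "S = (\<Sum>j\<le>n. \<bar>\<beta> j\<bar>)"
    have v_l1: "v \<in> l1"
      unfolding v_def using b_l1 by (intro subspace_sum[OF l1.subspace_V] subspace_scale[OF l1.subspace_V])
    have v_norm: "l1_norm v = S"
      unfolding v_def S_def using b_l1 b_norm b_disj r
      by (intro l1_norm_disjoint_sum) (auto simp: strict_mono_eq)
    have v_supp: "v i = 0" if "i < n0 \<or> s (Suc (r n)) \<le> i" for i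
    proof -
      have "b (r j) i = 0" if "j \<le> n" for j
        using b_supp[of "r j" i] s_mono[of 0 "r j"] s_mono[of "Suc (r j)" "Suc (r n)"] s(1)
          strict_mono_leD[OF r that] \<open>i < n0 \<or> s (Suc (r n)) \<le> i\<close> by linarith
      then show ?thesis
        by (simp add: v_def fun_sum_apply fun_scaleR_apply)
    qed
    have "d * q * L * S \<le> N (T v)"
    proof (cases "S = 0")
      case True
      then show ?thesis
        using N_nonneg[OF TV[OF v_l1]] by simp
    next
      case False
      have S: "0 < S"
        using False by (simp add: S_def sum_nonneg order.not_eq_order_implies_strict)
      have "l1_norm ((1 / S) *\<^sub>R v) = 1"
        using S by (simp add: l1.N_scaleR[OF v_l1] v_norm)
      moreover have "\<forall>i. i < n0 \<or> s (Suc (r n)) \<le> i \<longrightarrow> ((1 / S) *\<^sub>R v) i = 0"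
        using v_supp by (simp add: fun_scaleR_apply)
      ultimately have "(1 / S) *\<^sub>R v \<in> D n0"
        unfolding D_def by blast
      then have "lam n0 \<le> N (T v) / S"
        using lam_le S by (fastforce simp: T_scale[OF v_l1] N_scaleR[OF TV[OF v_l1]])
      then have "lam n0 * S \<le> N (T v)"
        using S by (simp add: pos_le_divide_eq)
      then show ?thesis
        using mult_strict_right_mono[OF n0 S] by linarith
    qed
    then have "d * S \<le> N (T v) / (q * L)"
      using qL by (simp add: pos_le_divide_eq mult_ac)
    also have "\<dots> = N ((1 / (q * L)) *\<^sub>R T v)"
      using qL by (simp add: N_scaleR[OF TV[OF v_l1]])
    also have "(1 / (q * L)) *\<^sub>R T v = (\<Sum>j\<le>n. \<beta> j *\<^sub>R x (r j))"
      unfolding v_def x_def T_sum[of "\<lambda>j. b (r j)", OF b_l1]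
      by (simp add: scaleR_sum_right mult.commute)
    finally show "d * (\<Sum>j\<le>n. \<bar>\<beta> j\<bar>) \<le> N (\<Sum>j\<le>n. \<beta> j *\<^sub>R x (r j))"
      by (simp add: S_def)
  qed
qed

text \<open>In c_m - c_n the terms up to m carry 1 / (m + 1) - 1 / (n + 1) and those after m carry -
  1 / (n + 1). Both groups have absolute sum (n - m) / (n + 1), so an almost isometric l1 basis with
  constant e / 2 gives the gap e.\<close>

lemma bs_eq_2_of_l1_copy:
  assumes "contains_l1_copy V N"
  shows "bs N (unit_ball V N) = 2"
proof (rule antisym[OF bs_le_2], rule dense_le_bounded[of 0])
  fix e :: real assume "0 < e" "e < 2"
  then have d: "0 < e / 2" "e / 2 < 1"
    by simp_all
  obtain x where x: "range x \<subseteq> unit_ball V N" and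
    lower: "\<And>(r :: nat \<Rightarrow> nat) \<beta> n. strict_mono r \<Longrightarrow> e / 2 * (\<Sum>j\<le>n. \<bar>\<beta> j\<bar>) \<le> N (\<Sum>j\<le>n. \<beta> j *\<^sub>R x (r j))"
    using James_distortion[OF assms d] by blast
  have "e \<le> cca_tilde N x"
  proof (rule cca_tilde_ge_of_cesaro_gap[OF x])
    fix r :: "nat \<Rightarrow> nat" and m n :: nat
    assume r: "strict_mono r" and mn: "m < n"
    define \<beta> where "\<beta> j = (if j \<le> m then 1 / real (Suc m) else 0) - 1 / real (Suc n)" for j
    have split: "{..n} = {..m} \<union> {m<..n}" "{..m} \<inter> {m<..n} = {}"
      using mn by auto
    have "cesaro (x \<circ> r) m - cesaro (x \<circ> r) n = (\<Sum>j\<le>n. \<beta> j *\<^sub>R x (r j))"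
    proof -
      have "(\<Sum>j\<le>n. (if j \<le> m then 1 / real (Suc m) else 0) *\<^sub>R x (r j)) = cesaro (x \<circ> r) m"
        unfolding split(1) by (subst sum.union_disjoint) (auto simp: cesaro_def scaleR_sum_right)
      then show ?thesis
        by (simp add: \<beta>_def scaleR_diff_left sum_subtractf cesaro_def[of _ n] scaleR_sum_right)
    qed
    moreover have "(\<Sum>j\<le>n. \<bar>\<beta> j\<bar>) = 2 * (real (n - m) / real (Suc n))"
    proof -
      have "(\<Sum>j\<le>m. \<bar>\<beta> j\<bar>) = (\<Sum>j\<le>m. 1 / real (Suc m) - 1 / real (Suc n))"
        using mn by (intro sum.cong refl) (simp add: \<beta>_def frac_le)
      moreover have "(\<Sum>j\<in>{m<..n}. \<bar>\<beta> j\<bar>) = (\<Sum>j\<in>{m<..n}. 1 / real (Suc n))"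
        by (intro sum.cong refl) (simp add: \<beta>_def)
      ultimately have "(\<Sum>j\<le>n. \<bar>\<beta> j\<bar>) =
          real (Suc m) * (1 / real (Suc m) - 1 / real (Suc n)) + real (n - m) * (1 / real (Suc n))"
        unfolding split(1) by (subst sum.union_disjoint) (auto simp del: of_nat_Suc)
      also have "\<dots> = 1 - real (Suc m) / real (Suc n) + real (n - m) / real (Suc n)"
        by (simp add: right_diff_distrib del: of_nat_Suc)
      also have "1 - real (Suc m) / real (Suc n) = real (n - m) / real (Suc n)"
        using mn by (simp add: field_simps of_nat_diff)
      also have "real (n - m) / real (Suc n) + real (n - m) / real (Suc n) = 2 * (real (n - m) / real (Suc n))"
        by simp
      finally show ?thesis .
    qed
    ultimately show "e * (real (n - m) / real (Suc n)) \<le> N (cesaro (x \<circ> r) m - cesaro (x \<circ> r) n)"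
      using lower[OF r, of \<beta> n] by simp
  qed
  then show "e \<le> bs N (unit_ball V N)"
    by (rule bs_ge[OF x])
qed simp

end

lemma contains_l1_copy_l1: "contains_l1_copy l1 l1_norm"
  unfolding contains_l1_copy_def by (intro exI[of _ id] conjI exI[of _ 1]) auto

section \<open>The Schur property\<close>

text \<open>The part of the duality between l1 and the bounded sequences that the hump argument
  needs.\<close>

lemma l1_bounded_functional:
  fixes y :: "nat \<Rightarrow> real"
  assumes y: "\<And>i. \<bar>y i\<bar> \<le> 1"
  shows "cont_lin_functional l1 l1_norm (\<lambda>z. \<Sum>i. y i * z i)"
proof -
  have le: "\<bar>y i * z i\<bar> \<le> \<bar>z i\<bar>" for z :: "nat \<Rightarrow> real" and i
    using mult_right_mono[OF y[of i], of "\<bar>z i\<bar>"] by (simp add: abs_mult)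
  have sum: "summable (\<lambda>i. \<bar>y i * z i\<bar>)" if "z \<in> l1" for z
  proof (rule summable_comparison_test'[where N = 0 and g = "\<lambda>i. \<bar>z i\<bar>"])
    show "summable (\<lambda>i. \<bar>z i\<bar>)"
      using that by (simp add: l1_def)
    show "norm \<bar>y i * z i\<bar> \<le> \<bar>z i\<bar>" for i
      using le[of i z] by simp
  qed
  have lin: "(\<Sum>i. y i * (a *\<^sub>R u + b *\<^sub>R v) i) = a * (\<Sum>i. y i * u i) + b * (\<Sum>i. y i * v i)"
    if "u \<in> l1" "v \<in> l1" for u v a b
  proof -
    note sums = summable_sums[OF summable_rabs_cancel[OF sum]]
    have "(\<lambda>i. a * (y i * u i) + b * (y i * v i)) sums (a * (\<Sum>i. y i * u i) + b * (\<Sum>i. y i * v i))"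
      by (rule sums_add[OF sums_mult[OF sums[OF that(1)]] sums_mult[OF sums[OF that(2)]]])
    moreover have "y i * (a *\<^sub>R u + b *\<^sub>R v) i = a * (y i * u i) + b * (y i * v i)" for i
      by (simp only: fun_scaleR_apply plus_fun_apply real_scaleR_def distrib_left mult.left_commute)
    ultimately show ?thesis
      by (simp only: sums_iff)
  qed
  have "\<bar>\<Sum>i. y i * z i\<bar> \<le> 1 * l1_norm z" if "z \<in> l1" for z
  proof -
    have "\<bar>\<Sum>i. y i * z i\<bar> \<le> (\<Sum>i. \<bar>y i * z i\<bar>)"
      by (rule summable_rabs[OF sum[OF that]])
    also have "\<dots> \<le> (\<Sum>i. \<bar>z i\<bar>)"
      using that by (intro suminf_le[OF le sum]) (simp_all add: l1_def)
    finally show ?thesis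
      by (simp add: l1_norm_def)
  qed
  with lin show ?thesis
    unfolding cont_lin_functional_def by (intro conjI ballI allI exI[of _ 1]) simp_all
qed

lemma tendsto_0_le_inverse:
  fixes f :: "nat \<Rightarrow> real"
  assumes "\<And>n. 0 \<le> f n" and le: "\<And>n. f n \<le> K * inverse (real (Suc n))"
  shows "f \<longlonglongrightarrow> 0"
proof (rule tendsto_sandwich)
  show "\<forall>\<^sub>F n in sequentially. 0 \<le> f n"
    using assms(1) by simp
  show "\<forall>\<^sub>F n in sequentially. f n \<le> K * inverse (real (Suc n))"
    by (intro always_eventually allI le)
  show "(\<lambda>n. K * inverse (real (Suc n))) \<longlonglongrightarrow> 0"
    by (rule tendsto_mult_right_zero[OF LIMSEQ_inverse_real_of_nat])
qed simp

lemma weakly_converges_diff: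
  assumes w: "weakly_converges_to V N x l" and f: "cont_lin_functional V N f"
  shows "(\<lambda>k. f (x k - l)) \<longlonglongrightarrow> 0"
proof -
  have "x k \<in> V" "l \<in> V" for k
    using w by (auto simp: weakly_converges_to_def)
  then have "f (x k - l) = f (x k) - f l" for k
    using f[unfolded cont_lin_functional_def, THEN conjunct1, rule_format, of "x k" l 1 "-1"] by simp
  moreover have "(\<lambda>k. f (x k) - f l) \<longlonglongrightarrow> f l - f l"
    using w f by (intro tendsto_diff tendsto_const) (simp add: weakly_converges_to_def)
  ultimately show ?thesis
    by simp
qed

text \<open>Otherwise infinitely many differences z k have norm at least \<delta>. As their
  coordinates tend to 0, a subsequence has almost all its mass on successive blocks. One sequence of
  signs, copied block by block from these vectors, is then a functional exceeding \<delta> / 2 on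
  the whole subsequence, against weak convergence to 0.\<close>

lemma l1_Schur:
  assumes w: "weakly_converges_to l1 l1_norm x l"
  shows "(\<lambda>k. l1_norm (x k - l)) \<longlonglongrightarrow> 0"
proof (rule ccontr)
  interpret normed_carrier l1 l1_norm
    by (rule normed_carrier_l1)
  define z where "z k = x k - l" for k
  have z: "z k \<in> l1" for k
    using w unfolding z_def weakly_converges_to_def by (intro subspace_diff[OF subspace_V]) auto
  have sum_z: "summable (\<lambda>i. \<bar>z k i\<bar>)" for k
    using z by (simp add: l1_def)
  have weak: "(\<lambda>k. \<Sum>i. y i * z k i) \<longlonglongrightarrow> 0" if "\<And>i. \<bar>y i\<bar> \<le> 1" for y
    using weakly_converges_diff[OF w l1_bounded_functional[OF that]] by (simp add: z_def)
  have coord: "(\<lambda>k. z k i) \<longlonglongrightarrow> 0" for i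
  proof -
    have "(\<Sum>j. (if j = i then 1 else 0) * z k j) = z k i" for k
      using suminf_finite[of "{i}" "\<lambda>j. (if j = i then 1 else 0) * z k j"] by simp
    then show ?thesis
      using weak[of "\<lambda>j. if j = i then 1 else 0"] by simp
  qed
  assume "\<not> (\<lambda>k. l1_norm (x k - l)) \<longlonglongrightarrow> 0"
  then obtain \<delta> where \<delta>: "0 < \<delta>" and "\<not> (\<forall>\<^sub>F k in sequentially. dist (l1_norm (x k - l)) 0 < \<delta>)"
    unfolding tendsto_iff by blast
  then have freq: "\<exists>\<^sub>F k in sequentially. \<delta> \<le> l1_norm (z k)"
    using N_nonneg[OF z] by (simp add: not_eventually not_less z_def)
  \<comment> \<open>The signs may be wrong outside the block, which costs twice the mass there: head
    and tail lose less than \<delta> / 4 each, so more than \<delta> / 2 remains.\<close>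
  define A where "A j n k \<longleftrightarrow> \<delta> \<le> l1_norm (z k) \<and> (\<Sum>i<n. \<bar>z k i\<bar>) < \<delta> / 8" for j n k :: nat
  define B where "B j k m \<longleftrightarrow> (\<Sum>i. \<bar>z k (i + m)\<bar>) < \<delta> / 8" for j k m :: nat
  have A: "\<exists>\<^sub>F k in sequentially. A j n k" for j n
  proof -
    have "(\<lambda>k. \<Sum>i<n. \<bar>z k i\<bar>) \<longlonglongrightarrow> (\<Sum>i<n. \<bar>0\<bar>)"
      by (intro tendsto_sum tendsto_rabs coord)
    then have "\<forall>\<^sub>F k in sequentially. (\<Sum>i<n. \<bar>z k i\<bar>) < \<delta> / 8"
      by (rule order_tendstoD(2)) (use \<delta> in simp)
    from frequently_eventually_frequently[OF freq this] show ?thesis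
      by (simp add: A_def)
  qed
  have B: "\<forall>\<^sub>F m in sequentially. B j k m" for j k
  proof -
    have "(\<lambda>m. \<Sum>i. \<bar>z k (i + m)\<bar>) \<longlonglongrightarrow> 0"
      by (rule suminf_exist_split2[OF sum_z])
    then show ?thesis
      unfolding B_def by (rule order_tendstoD(2)) (use \<delta> in simp)
  qed
  obtain r s where r: "strict_mono r" and s: "strict_mono s" "s 0 = 0"
    and A: "\<And>j. A j (s j) (r j)" and B: "\<And>j. B j (r j) (s (Suc j))"
    by (rule gliding_hump[of A B, OF A B]) (rule that)
  have "\<exists>p. s p \<le> i \<and> i < s (Suc p)" for i
    by (rule strict_mono_block[OF s, of i]) blast
  then obtain p where "\<And>i. s (p i) \<le> i \<and> i < s (Suc (p i))"
    by metis
  then have p: "\<And>i. s (p i) \<le> i" "\<And>i. i < s (Suc (p i))"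
    by blast+
  have p_eq: "p i = j" if "s j \<le> i" "i < s (Suc j)" for i j
  proof -
    have "s (p i) < s (Suc j)" "s j < s (Suc (p i))"
      using that p[of i] by linarith+
    then show ?thesis
      by (simp add: strict_mono_less[OF s(1)])
  qed
  define y where "y i = sgn (z (r (p i)) i)" for i
  have y: "\<bar>y i\<bar> \<le> 1" for i
    by (simp add: y_def abs_sgn_eq)
  have lower: "\<delta> / 2 < (\<Sum>i. y i * z (r j) i)" for j
  proof -
    define u where "u = z (r j)"
    \<comment> \<open>The loss against the full norm at coordinate i. It vanishes on block j, where
      y is the sign of u.\<close>
    define g where "g i = \<bar>u i\<bar> - y i * u i" for i
    have sum_u: "summable (\<lambda>i. \<bar>u i\<bar>)"
      by (simp add: u_def sum_z)
    have yu: "\<bar>y i * u i\<bar> \<le> \<bar>u i\<bar>" for i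
      using mult_right_mono[OF y[of i], of "\<bar>u i\<bar>"] by (simp add: abs_mult)
    have sum_yu: "summable (\<lambda>i. y i * u i)"
      by (rule summable_comparison_test'[OF sum_u, of 0]) (unfold real_norm_def, rule yu)
    have g_le: "g i \<le> 2 * \<bar>u i\<bar>" for i
      using yu[of i] unfolding g_def by linarith
    have sum_g: "summable g"
      unfolding g_def[abs_def] by (rule summable_diff[OF sum_u sum_yu])
    have block: "g i = 0" if "s j \<le> i" "i < s (Suc j)" for i
      unfolding g_def y_def u_def p_eq[OF that] by (simp add: abs_sgn)
    have "(\<Sum>i<s (Suc j). g i) = (\<Sum>i<s j. g i)"
    proof (rule sum.mono_neutral_right)
      show "{..<s j} \<subseteq> {..<s (Suc j)}"
        using strict_mono_leD[OF s(1), of j "Suc j"] by simp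
      show "\<forall>i\<in>{..<s (Suc j)} - {..<s j}. g i = 0"
        by (intro ballI block) simp_all
    qed simp
    also have "\<dots> \<le> (\<Sum>i<s j. 2 * \<bar>u i\<bar>)"
      by (intro sum_mono g_le)
    also have "\<dots> < \<delta> / 4"
    proof -
      have "(\<Sum>i<s j. 2 * \<bar>u i\<bar>) = 2 * (\<Sum>i<s j. \<bar>u i\<bar>)"
        by (rule sum_distrib_left[symmetric])
      then show ?thesis
        using A[of j] unfolding A_def u_def by linarith
    qed
    finally have head: "(\<Sum>i<s (Suc j). g i) < \<delta> / 4" .
    have "(\<Sum>i. g (i + s (Suc j))) \<le> (\<Sum>i. 2 * \<bar>u (i + s (Suc j))\<bar>)"
      by (rule suminf_le[OF g_le summable_ignore_initial_segment[OF sum_g]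
            summable_mult[OF summable_ignore_initial_segment[OF sum_u]]])
    also have "\<dots> = 2 * (\<Sum>i. \<bar>u (i + s (Suc j))\<bar>)"
      by (rule suminf_mult[OF summable_ignore_initial_segment[OF sum_u]])
    also have "\<dots> < \<delta> / 4"
      using B[of j] unfolding B_def u_def by linarith
    finally have "(\<Sum>i. g i) < \<delta> / 2"
      using head suminf_split_initial_segment[OF sum_g, of "s (Suc j)"] by linarith
    moreover have "(\<Sum>i. g i) = l1_norm u - (\<Sum>i. y i * u i)"
      unfolding g_def[abs_def] l1_norm_def by (rule suminf_diff[OF sum_u sum_yu, symmetric])
    ultimately show ?thesis
      using A[of j] unfolding A_def u_def by linarith
  qed
  have "\<forall>\<^sub>F j in sequentially. (\<Sum>i. y i * z (r j) i) < \<delta> / 2"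
    using order_tendstoD(2)[OF LIMSEQ_subseq_LIMSEQ[OF weak[OF y] r], of "\<delta> / 2"] \<delta>
    unfolding comp_def by simp
  then obtain j where "(\<Sum>i. y i * z (r j) i) < \<delta> / 2"
    using eventually_happens'[OF sequentially_bot] by blast
  with lower[of j] show False
    by linarith
qed

lemma wbs_l1: "wbs l1 l1_norm (unit_ball l1 l1_norm) = 0"
proof -
  interpret normed_carrier l1 l1_norm
    by (rule normed_carrier_l1)
  show ?thesis
  proof (rule wbs_eq_0)
    fix x l assume x: "range x \<subseteq> unit_ball l1 l1_norm" and w: "weakly_converges_to l1 l1_norm x l"
    have l: "l \<in> l1" and V: "range x \<subseteq> l1"
      using w by (auto simp: weakly_converges_to_def)
    have "\<exists>\<^sub>F k in sequentially. l1_norm (x k - l) < (1 / 2) ^ j" for j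
      using order_tendstoD(2)[OF l1_Schur[OF w], of "(1 / 2) ^ j"]
      by (intro eventually_frequently) auto
    \<comment> \<open>With a trivial second condition \<open>gliding_hump\<close> is a plain choice
      of a fast converging subsequence; the errors sum to at most 2, so the means converge at rate 2
      / (n + 1).\<close>
    then obtain r :: "nat \<Rightarrow> nat" where r: "strict_mono r"
      and small: "\<And>j. l1_norm (x (r j) - l) < (1 / 2) ^ j"
      using gliding_hump[of "\<lambda>j n k. l1_norm (x k - l) < (1 / 2) ^ j" "\<lambda>_ _ _. True", OF _ always_eventually]
      by blast
    show "cca_tilde l1_norm x \<le> 0"
    proof (rule cca_tilde_le_0[OF x l r])
      have bound: "l1_norm (cesaro (x \<circ> r) n - l) \<le> 2 * inverse (real (Suc n))" for n
      proof -
        have eq: "cesaro (\<lambda>j. x (r j) - l) n = cesaro (x \<circ> r) n - l"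
          by (simp add: cesaro_def sum_subtractf scaleR_diff_right sum_constant_scaleR del: sum_constant)
        have sums: "(\<Sum>j\<le>n. l1_norm (x (r j) - l)) \<le> (\<Sum>j\<le>n. (1 / 2) ^ j)"
          using small by (intro sum_mono less_imp_le)
        have "l1_norm (cesaro (\<lambda>j. x (r j) - l) n) \<le> (\<Sum>j\<le>n. l1_norm (x (r j) - l)) / real (Suc n)"
          using V l by (intro N_cesaro_le) (auto intro!: subspace_diff[OF subspace_V])
        also have "\<dots> \<le> 2 / real (Suc n)"
          by (rule divide_right_mono[OF order_trans[OF sums sum_half_powers_le]]) simp
        finally show ?thesis
          unfolding eq divide_inverse .
      qed
      have "0 \<le> l1_norm (cesaro (x \<circ> r) n - l)" for n
        using V l by (intro N_nonneg subspace_diff[OF subspace_V] cesaro_in_V) auto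
      then show "(\<lambda>n. l1_norm (cesaro (x \<circ> r) n - l)) \<longlonglongrightarrow> 0"
        by (rule tendsto_0_le_inverse[OF _ bound])
    qed
  qed
qed

section \<open>The spaces \<open>c\<^sub>0\<close> and \<open>c\<close>\<close>

lemma abs_lim_le_sup_norm: "x \<in> c_conv \<Longrightarrow> \<bar>lim x\<bar> \<le> sup_norm x"
  by (rule LIMSEQ_le_const2[OF tendsto_rabs]) (auto simp: c_conv_def convergent_LIMSEQ_iff intro!: abs_le_sup_norm)

text \<open>Subtracting from x k - l its limit t k leaves vectors of c0 that tend to 0
  coordinatewise, so the multiples in \<open>c0_subseq_cesaro\<close> vanish and their means are
  uniformly small. The t (r j) are summable and add only 2 / (n + 1). The lemma serves both c0 and
  c.\<close>

lemma c_conv_subseq_cesaro_tendsto: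
  assumes x: "range x \<subseteq> unit_ball c_conv sup_norm" and l: "l \<in> c_conv"
    and coord: "\<And>i. (\<lambda>k. x k i) \<longlonglongrightarrow> l i" and lims: "(\<lambda>k. lim (x k)) \<longlonglongrightarrow> lim l"
  obtains r where "strict_mono r" "(\<lambda>n. sup_norm (cesaro (x \<circ> r) n - l)) \<longlonglongrightarrow> 0"
proof -
  interpret normed_carrier c_conv sup_norm
    by (rule normed_carrier_c_conv)
  have xc: "x k \<in> c_conv" and x1: "sup_norm (x k) \<le> 1" for k
    using x by (auto simp: unit_ball_def)
  define t where "t k = lim (x k) - lim l" for k
  define z where "z k i = x k i - l i - t k" for k i
  \<comment> \<open>Entries of x k are at most 1, those of l at most its norm, and t k is at most
    the sum of the two.\<close>
  define b where "b = 2 + 2 * sup_norm l"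
  have LIM: "x k \<longlonglongrightarrow> lim (x k)" "l \<longlonglongrightarrow> lim l" for k
    using xc l by (simp_all add: c_conv_def convergent_LIMSEQ_iff)
  have "(\<lambda>i. x k i - l i - t k) \<longlonglongrightarrow> lim (x k) - lim l - t k" for k
    by (intro tendsto_intros LIM)
  then have z: "z k \<in> c0" for k
    by (simp add: c0_def z_def[abs_def] t_def)
  have zb: "\<bar>z k i\<bar> \<le> b" for k i
    using abs_le_sup_norm[OF xc[of k], of i] abs_le_sup_norm[OF l, of i] x1[of k]
      abs_lim_le_sup_norm[OF xc[of k]] abs_lim_le_sup_norm[OF l]
    by (simp add: z_def t_def b_def)
  have t: "t \<longlonglongrightarrow> 0"
    using tendsto_diff[OF lims tendsto_const, of "lim l"] by (simp add: t_def[abs_def])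
  have zlim: "(\<lambda>k. z k i) \<longlonglongrightarrow> 0" for i
    using tendsto_diff[OF tendsto_diff[OF coord tendsto_const] t, of i "l i"] by (simp add: z_def)
  obtain r where r: "strict_mono r" and tr: "\<And>j. \<bar>t (r j)\<bar> \<le> (1 / 2) ^ j"
    and ces: "\<And>n i. \<exists>\<alpha>. 0 \<le> \<alpha> \<and> \<alpha> \<le> 1 \<and> \<bar>cesaro (z \<circ> r) n i - \<alpha> * 0\<bar> \<le> (b + 2) / real (Suc n)"
    using c0_subseq_cesaro[OF z zb zlim t] by blast
  have bound: "sup_norm (cesaro (x \<circ> r) n - l) \<le> (b + 4) * inverse (real (Suc n))" for n
  proof (rule sup_norm_le)
    fix i
    have "(\<Sum>j\<le>n. z (r j) i) = (\<Sum>j\<le>n. x (r j) i) - real (Suc n) * l i - (\<Sum>j\<le>n. t (r j))"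
      by (simp add: z_def sum_subtractf)
    then have eq: "(cesaro (x \<circ> r) n - l) i = cesaro (z \<circ> r) n i + (\<Sum>j\<le>n. t (r j)) / real (Suc n)"
      by (simp add: cesaro_apply diff_divide_distrib del: of_nat_Suc)
    have "\<bar>\<Sum>j\<le>n. t (r j)\<bar> \<le> (\<Sum>j\<le>n. \<bar>t (r j)\<bar>)"
      by (rule sum_abs)
    also have "\<dots> \<le> 2"
      using sum_mono[of "{..n}", OF tr] sum_half_powers_le[of "{..n}"] by (rule order_trans)
    finally have "\<bar>(\<Sum>j\<le>n. t (r j)) / real (Suc n)\<bar> \<le> 2 / real (Suc n)"
      by (simp add: abs_divide divide_right_mono)
    moreover have "\<bar>cesaro (z \<circ> r) n i\<bar> \<le> (b + 2) / real (Suc n)"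
      using ces[of n i] by auto
    ultimately have "\<bar>(cesaro (x \<circ> r) n - l) i\<bar> \<le> (b + 2) / real (Suc n) + 2 / real (Suc n)"
      unfolding eq by linarith
    also have "\<dots> = (b + 4) * inverse (real (Suc n))"
      by (simp add: divide_inverse algebra_simps)
    finally show "\<bar>(cesaro (x \<circ> r) n - l) i\<bar> \<le> (b + 4) * inverse (real (Suc n))" .
  qed
  have "0 \<le> sup_norm (cesaro (x \<circ> r) n - l)" for n
    using xc l by (intro sup_norm_nonneg subspace_diff[OF subspace_V] cesaro_in_V) auto
  then have "(\<lambda>n. sup_norm (cesaro (x \<circ> r) n - l)) \<longlonglongrightarrow> 0"
    by (rule tendsto_0_le_inverse[OF _ bound])
  with r show thesis
    by (rule that)
qed

lemma weakly_converges_coordinate: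
  assumes V: "V \<subseteq> c_conv" and w: "weakly_converges_to V sup_norm x l"
  shows "(\<lambda>k. x k i) \<longlonglongrightarrow> l i"
proof -
  have "cont_lin_functional V sup_norm (\<lambda>x. x i)"
    unfolding cont_lin_functional_def using V abs_le_sup_norm
    by (auto simp: fun_scaleR_apply intro!: exI[of _ 1])
  then show ?thesis
    using w unfolding weakly_converges_to_def by blast
qed

lemma wbs_c0: "wbs c0 sup_norm (unit_ball c0 sup_norm) = 0"
proof -
  interpret normed_carrier c0 sup_norm
    by (rule normed_carrier_c0)
  show ?thesis
  proof (rule wbs_eq_0)
    fix x l assume x: "range x \<subseteq> unit_ball c0 sup_norm" and w: "weakly_converges_to c0 sup_norm x l"
    have l: "l \<in> c0" and xc: "\<And>k. x k \<in> c0"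
      using w by (auto simp: weakly_converges_to_def)
    have "lim (x k) = 0" "lim l = 0" for k
      using l xc by (auto simp: c0_def intro: limI)
    then have lims: "(\<lambda>k. lim (x k)) \<longlonglongrightarrow> lim l"
      by simp
    have "range x \<subseteq> unit_ball c_conv sup_norm" "l \<in> c_conv"
      using x l c0_subset_c_conv by (auto simp: unit_ball_def)
    from c_conv_subseq_cesaro_tendsto[OF this weakly_converges_coordinate[OF c0_subset_c_conv w] lims]
    obtain r where "strict_mono r" "(\<lambda>n. sup_norm (cesaro (x \<circ> r) n - l)) \<longlonglongrightarrow> 0"
      by blast
    then show "cca_tilde sup_norm x \<le> 0"
      by (rule cca_tilde_le_0[OF x l])
  qed
qed

lemma wbs_c_conv: "wbs c_conv sup_norm (unit_ball c_conv sup_norm) = 0"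
proof -
  interpret normed_carrier c_conv sup_norm
    by (rule normed_carrier_c_conv)
  have lin: "lim (a *\<^sub>R u + b *\<^sub>R v) = a * lim u + b * lim v"
    if "u \<in> c_conv" "v \<in> c_conv" for u v a b
  proof -
    have "(\<lambda>i. a * u i + b * v i) \<longlonglongrightarrow> a * lim u + b * lim v"
      using that by (intro tendsto_intros) (simp_all add: c_conv_def convergent_LIMSEQ_iff)
    then show ?thesis
      by (intro limI) (simp add: plus_fun_def scaleR_fun_def)
  qed
  \<comment> \<open>On c the limit is itself a bounded functional, so weak convergence includes
    convergence of the limits.\<close>
  then have "cont_lin_functional c_conv sup_norm lim"
    unfolding cont_lin_functional_def using abs_lim_le_sup_norm by (auto intro!: exI[of _ 1])
  then have lims: "(\<lambda>k. lim (x k)) \<longlonglongrightarrow> lim l" if "weakly_converges_to c_conv sup_norm x l" for x l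
    using that by (simp add: weakly_converges_to_def)
  show ?thesis
  proof (rule wbs_eq_0)
    fix x l assume x: "range x \<subseteq> unit_ball c_conv sup_norm" and w: "weakly_converges_to c_conv sup_norm x l"
    have l: "l \<in> c_conv"
      using w by (auto simp: weakly_converges_to_def)
    from c_conv_subseq_cesaro_tendsto[OF x this weakly_converges_coordinate[OF order_refl w] lims[OF w]]
    obtain r where "strict_mono r" "(\<lambda>n. sup_norm (cesaro (x \<circ> r) n - l)) \<longlonglongrightarrow> 0"
      by blast
    then show "cca_tilde sup_norm x \<le> 0"
      by (rule cca_tilde_le_0[OF x l])
  qed
qed

text \<open>The jump from 1 to a moves to the right with k, so at one coordinate the terms up to m
  equal a and all later ones equal 1. The choice a = - 1 in c gives 2, and a = 0 in c0 gives
  1.\<close>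

lemma step_bs_ge:
  assumes V: "normed_carrier V sup_norm" "V \<subseteq> c_conv"
    and step: "\<And>k::nat. (\<lambda>i. if i \<le> k then 1 else a) \<in> V" and a: "\<bar>a\<bar> \<le> 1"
  shows "1 - a \<le> bs sup_norm (unit_ball V sup_norm)"
proof -
  interpret normed_carrier V sup_norm
    by (rule V)
  define x :: "nat \<Rightarrow> nat \<Rightarrow> real" where "x k i = (if i \<le> k then 1 else a)" for k i
  have "x k \<in> unit_ball V sup_norm" for k
  proof -
    have "sup_norm (x k) \<le> 1"
      using a by (intro sup_norm_le) (simp add: x_def)
    then show ?thesis
      using step[of k] by (simp add: unit_ball_def x_def[abs_def])
  qed
  then have x: "range x \<subseteq> unit_ball V sup_norm"
    by blast
  then have xV: "range x \<subseteq> V"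
    by (auto simp: unit_ball_def)
  have "1 - a \<le> cca_tilde sup_norm x"
  proof (rule cca_tilde_ge_of_cesaro_gap[OF x])
    fix r :: "nat \<Rightarrow> nat" and m n :: nat
    assume r: "strict_mono r" and mn: "m < n"
    \<comment> \<open>The first coordinate behind the jump of term m of the subsequence; every later
      term still equals 1 there.\<close>
    define i where "i = Suc (r m)"
    have before: "x (r j) i = a" if "j \<le> m" for j
      using strict_mono_leD[OF r that] by (simp add: x_def i_def)
    have after: "x (r j) i = 1" if "m < j" for j
      using strict_monoD[OF r that] by (simp add: x_def i_def Suc_le_eq)
    have m: "cesaro (x \<circ> r) m i = a"
      by (simp add: cesaro_apply before)
    have "(cesaro (x \<circ> r) m - cesaro (x \<circ> r) n) i =
        (1 / real (Suc n)) * (\<Sum>j\<in>{m<..n}. cesaro (x \<circ> r) m i - x (r j) i)"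
      by (simp only: cesaro_split[OF mn] fun_scaleR_apply fun_sum_apply minus_apply real_scaleR_def o_apply)
    also have "(\<Sum>j\<in>{m<..n}. cesaro (x \<circ> r) m i - x (r j) i) = (\<Sum>j\<in>{m<..n}. a - 1)"
      by (intro sum.cong refl) (simp add: m after)
    also have "(1 / real (Suc n)) * \<dots> = - ((1 - a) * (real (n - m) / real (Suc n)))"
      by (simp add: algebra_simps diff_divide_distrib)
    finally have "(1 - a) * (real (n - m) / real (Suc n)) \<le> \<bar>(cesaro (x \<circ> r) m - cesaro (x \<circ> r) n) i\<bar>"
      by linarith
    moreover have "cesaro (x \<circ> r) m - cesaro (x \<circ> r) n \<in> c_conv"
    proof -
      have "range (x \<circ> r) \<subseteq> V"
        using xV by auto
      then show ?thesis
        using subspace_diff[OF subspace_V] cesaro_in_V V(2) by blast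
    qed
    ultimately show "(1 - a) * (real (n - m) / real (Suc n)) \<le> sup_norm (cesaro (x \<circ> r) m - cesaro (x \<circ> r) n)"
      using abs_le_sup_norm[of "cesaro (x \<circ> r) m - cesaro (x \<circ> r) n" i] by linarith
  qed
  then show ?thesis
    by (rule bs_ge[OF x])
qed

lemma step_tendsto: "(\<lambda>i. if i \<le> k then 1 else a) \<longlonglongrightarrow> a" for a :: real and k :: nat
  by (rule tendsto_eventually[OF eventually_mono[OF eventually_gt_at_top[of k]]]) simp

lemma bs_c_conv: "bs sup_norm (unit_ball c_conv sup_norm) = 2"
proof (rule antisym)
  have "(\<lambda>i. if i \<le> k then 1 else - 1) \<in> c_conv" for k :: nat
    using convergentI[OF step_tendsto[of k "- 1"]] by (simp add: c_conv_def)
  from step_bs_ge[OF normed_carrier_c_conv order_refl this]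
  show "2 \<le> bs sup_norm (unit_ball c_conv sup_norm)"
    by simp
qed (rule normed_carrier.bs_le_2[OF normed_carrier_c_conv])

lemma bs_c0: "bs sup_norm (unit_ball c0 sup_norm) = 1"
proof (rule antisym)
  have "(\<lambda>i. if i \<le> k then 1 else 0) \<in> c0" for k :: nat
    using step_tendsto[of k 0] by (simp add: c0_def)
  from step_bs_ge[OF normed_carrier_c0 c0_subset_c_conv this]
  show "1 \<le> bs sup_norm (unit_ball c0 sup_norm)"
    by simp
  interpret normed_carrier c0 sup_norm
    by (rule normed_carrier_c0)
  show "bs sup_norm (unit_ball c0 sup_norm) \<le> 1"
  proof (rule bs_le)
    fix x :: "nat \<Rightarrow> nat \<Rightarrow> real" assume x: "range x \<subseteq> unit_ball c0 sup_norm"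
    have xc: "x k \<in> c0" and norm_x: "sup_norm (x k) \<le> 1" for k
      using x by (auto simp: unit_ball_def)
    have x1: "\<bar>x k i\<bar> \<le> 1" for k i
      by (rule order_trans[OF abs_le_sup_norm norm_x]) (use xc c0_subset_c_conv in blast)
    obtain r1 y where r1: "strict_mono r1" and y: "\<And>i. (\<lambda>k. x (r1 k) i) \<longlonglongrightarrow> y i" "\<And>i. \<bar>y i\<bar> \<le> 1"
      by (rule pointwise_convergent_subsequence[of x 1, OF x1]) (rule that)
    obtain r2 where r2: "strict_mono r2"
      and ces: "\<And>n i. \<exists>\<alpha>. 0 \<le> \<alpha> \<and> \<alpha> \<le> 1 \<and> \<bar>cesaro ((\<lambda>k. x (r1 k)) \<circ> r2) n i - \<alpha> * y i\<bar> \<le> (1 + 2) / real (Suc n)"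
      by (rule c0_subseq_cesaro[of "\<lambda>k. x (r1 k)" 1 y "\<lambda>_. 0", OF xc x1 y(1) tendsto_const]) (rule that)
    define r where "r = r1 \<circ> r2"
    have r: "strict_mono r"
      unfolding r_def by (intro strict_mono_o r1 r2)
    have ces_r: "\<exists>\<alpha>. 0 \<le> \<alpha> \<and> \<alpha> \<le> 1 \<and> \<bar>cesaro (x \<circ> r) n i - \<alpha> * y i\<bar> \<le> 3 / real (Suc n)" for n i
      using ces[of n i] unfolding r_def comp_def by simp
    show "cca_tilde sup_norm x \<le> 1"
    proof (rule cca_tilde_le[OF x r], rule field_le_epsilon)
      fix e :: real assume e: "0 < e"
      \<comment> \<open>Two means are compared, each with error 3 / (k + 1), so each error may be at
        most e / 2.\<close>
      obtain n where n: "inverse (real (Suc n)) < e / 6"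
        using reals_Archimedean[of "e / 6"] e by auto
      have small: "3 / real (Suc k) \<le> e / 2" if "n \<le> k" for k
      proof -
        have "inverse (real (Suc k)) \<le> inverse (real (Suc n))"
          using that by (intro le_imp_inverse_le) auto
        with n have "3 * inverse (real (Suc k)) \<le> e / 2"
          by linarith
        then show ?thesis
          by (simp only: divide_inverse)
      qed
      show "cca sup_norm (x \<circ> r) \<le> 1 + e"
        unfolding cca_def
      proof (rule ca_le[OF range_cesaro_comp[OF x], of n], rule sup_norm_le)
        fix k l i assume kl: "n \<le> k" "n \<le> l"
        obtain \<alpha> \<beta> where \<alpha>: "0 \<le> \<alpha>" "\<alpha> \<le> 1" "\<bar>cesaro (x \<circ> r) k i - \<alpha> * y i\<bar> \<le> 3 / real (Suc k)"
          and \<beta>: "0 \<le> \<beta>" "\<beta> \<le> 1" "\<bar>cesaro (x \<circ> r) l i - \<beta> * y i\<bar> \<le> 3 / real (Suc l)"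
          using ces_r[of k i] ces_r[of l i] by blast
        \<comment> \<open>Both means are multiples of the same y i with factors in [0,1]. This keeps
          the oscillation at 1 instead of the trivial 2.\<close>
        have "\<bar>(\<alpha> - \<beta>) * y i\<bar> \<le> 1 * 1"
          unfolding abs_mult using \<alpha> \<beta> y(2)[of i] by (intro mult_mono) auto
        then have "\<bar>\<alpha> * y i - \<beta> * y i\<bar> \<le> 1"
          by (simp add: left_diff_distrib)
        then show "\<bar>(cesaro (x \<circ> r) k - cesaro (x \<circ> r) l) i\<bar> \<le> 1 + e"
          using \<alpha>(3) \<beta>(3) small[OF kl(1)] small[OF kl(2)] unfolding minus_apply by linarith
      qed
    qed
  qed
qed

theorem theorem5p2:
  shows "(contains_l1_copy (UNIV::'a::banach set) norm \<longrightarrow> bs norm (cball (0::'a) 1) = 2)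
    \<and> bs l1_norm (unit_ball l1 l1_norm) = 2
    \<and> wbs l1 l1_norm (unit_ball l1 l1_norm) = 0
    \<and> ((\<not> reflexive_space TYPE('b::banach) \<and> \<not> contains_l1_copy (UNIV::'b set) norm) \<longrightarrow>
         1 \<le> bs norm (cball (0::'b) 1) \<and> bs norm (cball (0::'b) 1) \<le> 2)
    \<and> bs sup_norm (unit_ball c0 sup_norm) = 1
    \<and> bs sup_norm (unit_ball c_conv sup_norm) = 2
    \<and> wbs c0 sup_norm (unit_ball c0 sup_norm) = 0
    \<and> wbs c_conv sup_norm (unit_ball c_conv sup_norm) = 0"
proof (intro conjI impI)
  show "bs norm (cball (0::'a) 1) = 2" if "contains_l1_copy (UNIV::'a set) norm"
    using normed_carrier.bs_eq_2_of_l1_copy[OF normed_carrier_UNIV that] by (simp only: unit_ball_UNIV)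
  show "bs l1_norm (unit_ball l1 l1_norm) = 2"
    by (rule normed_carrier.bs_eq_2_of_l1_copy[OF normed_carrier_l1 contains_l1_copy_l1])
  show "1 \<le> bs norm (cball (0::'b) 1)"
    if "\<not> reflexive_space TYPE('b) \<and> \<not> contains_l1_copy (UNIV::'b set) norm"
    using that by (intro nonreflexive_bs_ge_1) (rule conjunct1)
  show "bs norm (cball (0::'b) 1) \<le> 2"
    using normed_carrier.bs_le_2[OF normed_carrier_UNIV[where 'a = 'b]] by (simp only: unit_ball_UNIV)
qed (rule wbs_l1 bs_c0 bs_c_conv wbs_c0 wbs_c_conv)+

end
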